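(* Let $D$ be a non-empty fourling shape and let $h$, $v$, $s$ be nonnegative integers. Then $$\sum_{\lambda} I_\lambda = 0,$$ where the sum is taken over all partition shapes $\lambda$ with fourling body $\mathrm{fb}(\lambda)=D$, exactly $s$ squares in the strip of $\lambda$, $\mathrm{hs}(\lambda)=h$ and $\mathrm{vs}(\lambda)=v$.
   Context: A shape $\lambda=(\lambda_1,\lambda_2,\ldots)$ is the Ferrers diagram of an integer partition; square $(r,c)$ is in row $r$ (counted from the top) and column $c$ (counted from the left); $\lambda\vdash n$ means $\lambda$ has $n$ squares. A standard Young tableau (SYT) on an $n$-shape is a filling of its squares with $1,\ldots,n$, each used once, increasing along rows (left to right) and down columns. The sign $\mathrm{sgn}(T)$ of a tableau is the sign of the word obtained by reading its entries row by row, left to right, top to bottom (like a book), where the sign of a word $w_1\cdots w_k$ of distinct integers is $(-1)^{|\{(i,j):i<j,\ w_i>w_j\}|}$. The sign-imbalance is $I_\lambda=\sum_{T\in\mathrm{SYT}(\lambda)}\mathrm{sgn}(T)$. A domino is a $1\times 2$ or $2\times1$ rectangle of two squares; a fourling is a $2\times 2$ square. A fourling shape is a (possibly empty) shape that is a union of fourlings, i.e. a shape $\mu$ with $\mu_{2i-1}=\mu_{2i}$ even for all $i$. The fourling body $\mathrm{fb}(\lambda)$ is the largest fourling shape contained in $\lambda$; the squares of $\lambda$ not in $\mathrm{fb}(\lambda)$ form the strip of $\lambda$. $\mathrm{vs}(\lambda)$ is the maximal number of disjoint vertical dominoes that fit in the strip of $\lambda$, and $\mathrm{hs}(\lambda)=\mathrm{vs}(\lambda')$,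 where $\lambda'$ is the conjugate (transpose) shape. *)

theory Defs
  imports Main "HOL-Library.FuncSet"
begin

text \<open>Squares are pairs \<open>(r, c)\<close> of a row and a column, both counted from 1.\<close>

type_synonym square = "nat \<times> nat"

definition is_partition :: "nat list \<Rightarrow> bool" where
  "is_partition lam \<longleftrightarrow> sorted_wrt (\<ge>) lam \<and> 0 \<notin> set lam"

definition ferrers :: "nat list \<Rightarrow> square set" where
  "ferrers lam = {(r, c). 1 \<le> r \<and> r \<le> length lam \<and> 1 \<le> c \<and> c \<le> lam ! (r - 1)}"

definition is_shape :: "square set \<Rightarrow> bool" where
  "is_shape S \<longleftrightarrow> (\<exists>lam. is_partition lam \<and> S = ferrers lam)"

text \<open>For a shape \<open>S\<close>, \<open>part S r\<close> is the \<open>r\<close>-th part of its partition (0 if there is none).\<close>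

definition part :: "square set \<Rightarrow> nat \<Rightarrow> nat" where
  "part S r = card {c. (r, c) \<in> S}"

definition conjugate :: "square set \<Rightarrow> square set" where
  "conjugate S = {(r, c). (c, r) \<in> S}"

text \<open>A filling is \<open>undefined\<close> outside the shape, so that distinct functions are distinct fillings.\<close>

definition SYT :: "square set \<Rightarrow> (square \<Rightarrow> nat) set" where
  "SYT S = {T \<in> extensional S. bij_betw T S {1..card S} \<and>
     (\<forall>r c c'. (r, c) \<in> S \<longrightarrow> (r, c') \<in> S \<longrightarrow> c < c' \<longrightarrow> T (r, c) < T (r, c')) \<and>
     (\<forall>r r' c. (r, c) \<in> S \<longrightarrow> (r', c) \<in> S \<longrightarrow> r < r' \<longrightarrow> T (r, c) < T (r', c))}"

definition word_sign :: "nat list \<Rightarrow> int" where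
  "word_sign w = (- 1) ^ card {(i, j). i < j \<and> j < length w \<and> w ! i > w ! j}"

definition reading_word :: "square set \<Rightarrow> (square \<Rightarrow> nat) \<Rightarrow> nat list" where
  "reading_word S T =
     concat (map (\<lambda>r. map (\<lambda>c. T (r, c)) [1..<Suc (part S r)]) [1..<Suc (card (fst ` S))])"

definition sgn_tableau :: "square set \<Rightarrow> (square \<Rightarrow> nat) \<Rightarrow> int" where
  "sgn_tableau S T = word_sign (reading_word S T)"

definition sign_imbalance :: "square set \<Rightarrow> int" where
  "sign_imbalance S = (\<Sum>T\<in>SYT S. sgn_tableau S T)"

definition fourling_shape :: "square set \<Rightarrow> bool" where
  "fourling_shape S \<longleftrightarrow> is_shape S \<and>
     (\<forall>i\<ge>1. part S (2 * i - 1) = part S (2 * i) \<and> even (part S (2 * i)))"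

text \<open>\<open>GREATEST\<close> refers to the inclusion order on sets of squares; the maximum exists by
  \<open>fb_greatest\<close> below.\<close>

definition fb :: "square set \<Rightarrow> square set" where
  "fb S = (GREATEST M. fourling_shape M \<and> M \<subseteq> S)"

definition strip :: "square set \<Rightarrow> square set" where
  "strip S = S - fb S"

definition vertical_domino :: "square set \<Rightarrow> bool" where
  "vertical_domino d \<longleftrightarrow> (\<exists>r c. d = {(r, c), (Suc r, c)})"

definition vs :: "square set \<Rightarrow> nat" where
  "vs S = Max {card F | F. (\<forall>d\<in>F. vertical_domino d \<and> d \<subseteq> strip S) \<and> pairwise disjnt F}"

definition hs :: "square set \<Rightarrow> nat" where
  "hs S = vs (conjugate S)"

lemma initial_segment:
  fixes A :: "nat set"
  assumes fin: "finite A" and ge1: "\<And>a. a \<in> A \<Longrightarrow> 1 \<le> a"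
    and down: "\<And>a b. a \<in> A \<Longrightarrow> 1 \<le> b \<Longrightarrow> b \<le> a \<Longrightarrow> b \<in> A"
  shows "A = {1..card A}"
proof (cases "A = {}")
  case False
  have "A = {1..Max A}"
  proof (intro equalityI subsetI)
    fix a assume "a \<in> A"
    then show "a \<in> {1..Max A}" using ge1 Max_ge[OF fin] by simp
  next
    fix b assume "b \<in> {1..Max A}"
    then show "b \<in> A" using down[OF Max_in[OF fin False]] by simp
  qed
  then show ?thesis by (metis card_atLeastAtMost diff_Suc_1)
qed simp

lemma is_shape_iff:
  "is_shape S \<longleftrightarrow> finite S \<and> (\<forall>r c. (r, c) \<in> S \<longrightarrow> 1 \<le> r \<and> 1 \<le> c) \<and>
     (\<forall>r c r' c'. (r, c) \<in> S \<longrightarrow> 1 \<le> r' \<longrightarrow> r' \<le> r \<longrightarrow> 1 \<le> c' \<longrightarrow> c' \<le> c \<longrightarrow> (r', c') \<in> S)"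
  (is "?L \<longleftrightarrow> ?R")
proof
  assume ?L
  then obtain lam where lam: "is_partition lam" "S = ferrers lam"
    by (auto simp: is_shape_def)
  have "S \<subseteq> {..length lam} \<times> {..sum_list lam}"
    using lam(2) by (auto simp: ferrers_def intro: order_trans[OF _ elem_le_sum_list])
  then have "finite S" by (rule finite_subset) auto
  moreover have "lam ! (r - 1) \<le> lam ! (r' - 1)" if "1 \<le> r'" "r' \<le> r" "r \<le> length lam" for r r'
    using lam(1) that sorted_wrt_nth_less[of "(\<ge>)" lam "r' - 1" "r - 1"]
    by (cases "r = r'") (auto simp: is_partition_def)
  then have "(r', c') \<in> S" if "(r, c) \<in> S" "1 \<le> r'" "r' \<le> r" "1 \<le> c'" "c' \<le> c" for r c r' c'
    using that lam(2) by (fastforce simp: ferrers_def)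
  moreover have "1 \<le> r \<and> 1 \<le> c" if "(r, c) \<in> S" for r c
    using that lam(2) by (auto simp: ferrers_def)
  ultimately show ?R by blast
next
  assume R: ?R
  have fin: "finite S"
    and ge1: "\<And>r c. (r, c) \<in> S \<Longrightarrow> 1 \<le> r" "\<And>r c. (r, c) \<in> S \<Longrightarrow> 1 \<le> c"
    and down: "\<And>r c r' c'. (r, c) \<in> S \<Longrightarrow> 1 \<le> r' \<Longrightarrow> r' \<le> r \<Longrightarrow> 1 \<le> c' \<Longrightarrow> c' \<le> c \<Longrightarrow> (r', c') \<in> S"
    using R by blast+
  have row: "{c. (r, c) \<in> S} = {1..part S r}" for r
    unfolding part_def
  proof (rule initial_segment)
    show "finite {c. (r, c) \<in> S}"
      by (rule finite_subset[OF _ finite_imageI[OF fin, of snd]]) force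
  qed (use ge1 down in blast)+
  then have mem: "(r, c) \<in> S \<longleftrightarrow> 1 \<le> c \<and> c \<le> part S r" for r c
    by (metis atLeastAtMost_iff mem_Collect_eq)
  have anti: "part S r \<le> part S r'" if "1 \<le> r'" "r' \<le> r" for r r'
  proof (cases "part S r = 0")
    case False
    then have "(r, part S r) \<in> S" by (simp add: mem)
    then have "(r', part S r) \<in> S" using that False down[of r "part S r" r' "part S r"] by simp
    then show ?thesis by (simp add: mem)
  qed simp
  define n where "n = card {r. (r, 1) \<in> S}"
  have n: "{r. (r, 1) \<in> S} = {1..n}"
    unfolding n_def
  proof (rule initial_segment)
    show "finite {r. (r, 1) \<in> S}"
      by (rule finite_subset[OF _ finite_imageI[OF fin, of fst]]) force
  qed (use ge1 down in blast)+
  have pos: "1 \<le> part S r \<longleftrightarrow> 1 \<le> r \<and> r \<le> n" for r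
    using n mem[of r 1] by (metis atLeastAtMost_iff le_refl mem_Collect_eq)
  define lam where "lam = map (\<lambda>i. part S (Suc i)) [0..<n]"
  have "sorted_wrt (\<ge>) lam"
    by (auto simp: lam_def sorted_wrt_iff_nth_less intro: anti)
  moreover have "part S (Suc i) \<noteq> 0" if "i < n" for i
    using pos[of "Suc i"] that by simp
  then have "0 \<notin> set lam" by (simp add: lam_def image_iff)
  ultimately have "is_partition lam" by (simp add: is_partition_def)
  moreover have "S = ferrers lam"
  proof (intro set_eqI iffI; clarify)
    fix r c assume "(r, c) \<in> S"
    then have "1 \<le> c" "c \<le> part S r" by (auto simp: mem)
    moreover from this have "1 \<le> r \<and> r \<le> n" using pos[of r] by linarith
    ultimately show "(r, c) \<in> ferrers lam" by (auto simp: ferrers_def lam_def)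
  qed (auto simp: ferrers_def lam_def mem)
  ultimately show ?L by (auto simp: is_shape_def)
qed

lemma shape_mem_iff:
  assumes "is_shape S"
  shows "(r, c) \<in> S \<longleftrightarrow> 1 \<le> c \<and> c \<le> part S r"
proof -
  obtain lam where lam: "S = ferrers lam" using assms by (auto simp: is_shape_def)
  show ?thesis
  proof (cases "1 \<le> r \<and> r \<le> length lam")
    case True
    then have "{c. (r, c) \<in> S} = {1..lam ! (r - 1)}" by (auto simp: lam ferrers_def)
    then show ?thesis using True by (auto simp: part_def lam ferrers_def)
  next
    case False
    then have "{c. (r, c) \<in> S} = {}" by (auto simp: lam ferrers_def)
    then show ?thesis by (auto simp: part_def)
  qed
qed

text \<open>A fourling shape is a shape that is a union of fourlings with odd top-left coordinates.\<close>

lemma fourling_shape_iff: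
  "fourling_shape S \<longleftrightarrow> is_shape S \<and>
     (\<forall>r c. (r, c) \<in> S \<longrightarrow> (2 * ((r + 1) div 2), 2 * ((c + 1) div 2)) \<in> S)"
  (is "_ \<longleftrightarrow> _ \<and> ?B")
proof (cases "is_shape S")
  case True
  note mem = shape_mem_iff[OF True]
  have down: "\<And>r c r' c'. (r, c) \<in> S \<Longrightarrow> 1 \<le> r' \<Longrightarrow> r' \<le> r \<Longrightarrow> 1 \<le> c' \<Longrightarrow> c' \<le> c \<Longrightarrow> (r', c') \<in> S"
    and ge1: "\<And>r c. (r, c) \<in> S \<Longrightarrow> 1 \<le> r \<and> 1 \<le> c"
    using True unfolding is_shape_iff by blast+
  have "?B" if F: "\<forall>i\<ge>1. part S (2 * i - 1) = part S (2 * i) \<and> even (part S (2 * i))"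
  proof (intro allI impI)
    fix r c assume rc: "(r, c) \<in> S"
    define i where "i = (r + 1) div 2"
    have "1 \<le> i" "r = 2 * i - 1 \<or> r = 2 * i" using ge1[OF rc] by (auto simp: i_def)
    then have "part S r = part S (2 * i)" "even (part S (2 * i))" using F by auto
    moreover from this have "2 * ((c + 1) div 2) \<le> part S (2 * i)"
      using rc by (auto simp: mem elim!: evenE)
    ultimately show "(2 * ((r + 1) div 2), 2 * ((c + 1) div 2)) \<in> S"
      using ge1[OF rc] by (auto simp: mem i_def)
  qed
  moreover have "part S (2 * i - 1) = part S (2 * i) \<and> even (part S (2 * i))"
    if B: ?B and i: "1 \<le> i" for i
  proof
    let ?p = "part S (2 * i - 1)" and ?q = "part S (2 * i)"
    have "?q \<le> ?p"
    proof (cases "?q = 0")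
      case False
      then have "(2 * i - 1, ?q) \<in> S"
        using down[of "2 * i" ?q "2 * i - 1" ?q] i by (auto simp: mem)
      then show ?thesis by (simp add: mem)
    qed simp
    moreover have "?p \<le> ?q"
    proof (cases "?p = 0")
      case False
      then have "(2 * i - 1, ?p) \<in> S" by (auto simp: mem)
      with B have "(2 * ((2 * i - 1 + 1) div 2), 2 * ((?p + 1) div 2)) \<in> S" by blast
      then show ?thesis using i by (auto simp: mem)
    qed simp
    ultimately show "?p = ?q" by simp
    show "even ?q"
    proof (cases "?q = 0")
      case False
      then have "(2 * i, ?q) \<in> S" by (auto simp: mem)
      with B have "(2 * ((2 * i + 1) div 2), 2 * ((?q + 1) div 2)) \<in> S" by blast
      then have "2 * ((?q + 1) div 2) \<le> ?q" by (auto simp: mem)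
      then show ?thesis by presburger
    qed simp
  qed
  ultimately show ?thesis using True unfolding fourling_shape_def by blast
qed (simp add: fourling_shape_def)

lemma fb_greatest:
  assumes "is_shape S"
  shows "fourling_shape (fb S)" "fb S \<subseteq> S"
    and "\<And>M. fourling_shape M \<Longrightarrow> M \<subseteq> S \<Longrightarrow> M \<subseteq> fb S"
proof -
  let ?U = "\<Union>{M. fourling_shape M \<and> M \<subseteq> S}"
  have "finite ?U"
    by (rule finite_subset[of _ S]) (use assms in \<open>auto simp: is_shape_iff\<close>)
  moreover have "1 \<le> r \<and> 1 \<le> c" if "(r, c) \<in> ?U" for r c
    using that assms unfolding is_shape_iff by blast
  moreover have "(r', c') \<in> ?U"
    if rc: "(r, c) \<in> ?U" and le: "1 \<le> r'" "r' \<le> r" "1 \<le> c'" "c' \<le> c" for r c r' c'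
  proof -
    obtain M where M: "fourling_shape M" "M \<subseteq> S" "(r, c) \<in> M" using rc by blast
    then have "is_shape M" by (simp add: fourling_shape_def)
    then have "(r', c') \<in> M" using M(3) le unfolding is_shape_iff by blast
    with M show ?thesis by blast
  qed
  ultimately have "is_shape ?U" unfolding is_shape_iff by blast
  moreover have "(2 * ((r + 1) div 2), 2 * ((c + 1) div 2)) \<in> ?U" if rc: "(r, c) \<in> ?U" for r c
  proof -
    obtain M where M: "fourling_shape M" "M \<subseteq> S" "(r, c) \<in> M" using rc by blast
    then have "(2 * ((r + 1) div 2), 2 * ((c + 1) div 2)) \<in> M"
      unfolding fourling_shape_iff by blast
    with M(1,2) show ?thesis by blast
  qed
  ultimately have "fourling_shape ?U" unfolding fourling_shape_iff by blast
  then have U: "fourling_shape ?U" "?U \<subseteq> S" by blast+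
  have "fb S = ?U" unfolding fb_def by (rule Greatest_equality) (use U in blast)+
  with U show "fourling_shape (fb S)" "fb S \<subseteq> S" by simp_all
  show "M \<subseteq> fb S" if "fourling_shape M" "M \<subseteq> S" for M
    unfolding \<open>fb S = ?U\<close> using that by blast
qed

lemma finite_shapes: "finite {S. is_shape S \<and> fb S = D \<and> card (strip S) = s}"
proof (rule finite_subset)
  let ?n = "card D + s"
  show "{S. is_shape S \<and> fb S = D \<and> card (strip S) = s} \<subseteq> Pow ({..?n} \<times> {..?n})"
  proof (clarify)
    fix S r c assume S: "is_shape S" "s = card (strip S)" "D = fb S" "(r, c) \<in> S"
    have fin: "finite S" using S(1) is_shape_iff by blast
    then have card: "card S = card (fb S) + card (strip S)"
      using fb_greatest(2)[OF S(1)] by (simp add: strip_def card_Diff_subset finite_subset card_mono)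
    have ge: "1 \<le> r" "1 \<le> c"
      and down: "\<And>r' c'. 1 \<le> r' \<Longrightarrow> r' \<le> r \<Longrightarrow> 1 \<le> c' \<Longrightarrow> c' \<le> c \<Longrightarrow> (r', c') \<in> S"
      using S(1,4) unfolding is_shape_iff by blast+
    have "(\<lambda>i. (i, c)) ` {1..r} \<subseteq> S" "(\<lambda>j. (r, j)) ` {1..c} \<subseteq> S"
      using ge by (auto intro: down)
    then have "card ((\<lambda>i. (i, c)) ` {1..r}) \<le> card S" "card ((\<lambda>j. (r, j)) ` {1..c}) \<le> card S"
      using fin by (auto intro: card_mono)
    then show "r \<in> {..card (fb S) + card (strip S)} \<and> c \<in> {..card (fb S) + card (strip S)}"
      using card by (simp add: card_image inj_on_def)
  qed
qed auto

end

theory Submission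
  imports Defs "HOL-Computational_Algebra.Polynomial"
begin

text \<open>
  A shape in a large square box is the word of the steps of its boundary, read from the north-east
  to the south-west; removing a corner exchanges two adjacent letters. Removing the largest entry
  of a tableau shows that the vector of sign-imbalances is obtained by iterating a signed
  corner-removal operator. Two signed sums commute with this operator up to a sign and a scalar, so
  each of them maps the vector of sign-imbalances to multiples of itself: the sum over all ways to
  add a horizontal strip (weight \<open>X\<close> per square) and then a vertical strip, and the sum over all
  ways to add black squares (squares of odd content). On a non-empty fourling shape the strip sum
  of the vector therefore vanishes, as the sign-imbalance of the shape does. On shapes whose
  imbalance is nonzero the number of white squares exceeds the number of black ones by 0 or 1.
  Comparing pairs of letters, the strip sum is there a nonzero multiple of the black sum composed
  with the weight \<open>(- X\<^sup>2) ^ hs\<close> on the shapes with the given fourling body. Hence these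
  weighted sums of sign-imbalances vanish for all \<open>X > 1\<close>, and so does each coefficient. Finally
  \<open>hs + vs\<close> is the number of black squares of the strip, which is half its size, rounded down.
\<close>

section \<open>Corner sums over boundary words\<close>

text \<open>
  A boundary word is read from the north-east to the south-west; \<open>False\<close> is a horizontal and
  \<open>True\<close> a vertical step. A vertical step ends a row whose length is the number of horizontal
  steps after it.
\<close>

primrec horiz :: "bool list \<Rightarrow> nat" where
  "horiz [] = 0"
| "horiz (b # l) = (if b then horiz l else Suc (horiz l))"

primrec area :: "bool list \<Rightarrow> nat" where
  "area [] = 0"
| "area (b # l) = (if b then horiz l else 0) + area l"

definition horiz_sign :: "bool list \<Rightarrow> real" where
  "horiz_sign l = (- 1) ^ horiz l"

definition area_sign :: "bool list \<Rightarrow> real" where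
  "area_sign l = (- 1) ^ area l"

lemma horiz_sign_simps [simp]:
  "horiz_sign [] = 1"
  "horiz_sign (True # l) = horiz_sign l"
  "horiz_sign (False # l) = - horiz_sign l"
  by (simp_all add: horiz_sign_def)

lemma area_sign_simps [simp]:
  "area_sign [] = 1"
  "area_sign (True # l) = horiz_sign l * area_sign l"
  "area_sign (False # l) = area_sign l"
  by (simp_all add: area_sign_def horiz_sign_def power_add)

lemma horiz_sign_mult_self [simp]:
  "horiz_sign l * horiz_sign l = 1"
  "horiz_sign l * (horiz_sign l * z) = z"
  by (simp_all add: horiz_sign_def flip: power_add mult.assoc)

lemma area_sign_mult_self [simp]:
  "area_sign l * area_sign l = 1"
  "area_sign l * (area_sign l * z) = z"
  by (simp_all add: area_sign_def flip: power_add mult.assoc)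

lemma horiz_append [simp]: "horiz (p @ q) = horiz p + horiz q"
  by (induction p) auto

lemma horiz_replicate [simp]: "horiz (replicate k b) = (if b then 0 else k)"
  by (induction k) auto

lemma horiz_le_length: "horiz l \<le> length l"
  by (induction l) auto

lemma area_append: "area (p @ q) = area p + area q + (length p - horiz p) * horiz q"
proof (induction p)
  case (Cons b p)
  then show ?case using horiz_le_length[of p] by (cases b) (auto simp: Suc_diff_le)
qed simp

lemma area_replicate [simp]: "area (replicate k b) = 0"
  by (induction k) auto

text \<open>
  Removing a corner of the shape replaces a factor \<open>True, False\<close> by \<open>False, True\<close>, and adding one
  does the converse. The predicate on the length of the word after it selects corners by their
  content.
\<close>

definition corner_exchange :: "bool \<Rightarrow> (nat \<Rightarrow> bool) \<Rightarrow> bool list \<Rightarrow> bool list \<Rightarrow> bool" where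
  "corner_exchange b P l t \<longleftrightarrow>
     (\<exists>p s. l = p @ b # (\<not> b) # s \<and> t = p @ (\<not> b) # b # s \<and> P (length s))"

abbreviation corner_removal :: "(nat \<Rightarrow> bool) \<Rightarrow> bool list \<Rightarrow> bool list \<Rightarrow> bool" where
  "corner_removal \<equiv> corner_exchange True"

lemma corner_exchange_False_iff: "corner_exchange False P l t \<longleftrightarrow> corner_removal P t l"
  by (auto simp: corner_exchange_def)

lemma corner_exchange_Cons: "corner_exchange b P l t \<Longrightarrow> corner_exchange b P (x # l) (x # t)"
  unfolding corner_exchange_def by (metis append_Cons)

lemma corner_exchange_hd: "P (length s) \<Longrightarrow> corner_exchange b P (b # (\<not> b) # s) ((\<not> b) # b # s)"
  unfolding corner_exchange_def by (metis append_Nil)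

lemma corner_removal_measures:
  assumes "corner_removal P l t"
  shows "length t = length l" "horiz t = horiz l" "area l = Suc (area t)"
  using assms by (auto simp: corner_exchange_def area_append)

text \<open>
  The squares after a corner in the reading order are those of the word after it, whence the sign
  in the sum over all exchanges.
\<close>

fun exchange_sum :: "bool \<Rightarrow> (nat \<Rightarrow> bool) \<Rightarrow> (bool list \<Rightarrow> real) \<Rightarrow> bool list \<Rightarrow> real" where
  "exchange_sum b P f (x # y # s) =
     (if x = b \<and> y = (\<not> b) \<and> P (length s) then area_sign s * f ((\<not> b) # b # s) else 0) +
     exchange_sum b P (\<lambda>t. f (x # t)) (y # s)"
| "exchange_sum b P f _ = 0"

abbreviation corner_sum_on :: "(nat \<Rightarrow> bool) \<Rightarrow> (bool list \<Rightarrow> real) \<Rightarrow> bool list \<Rightarrow> real" where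
  "corner_sum_on \<equiv> exchange_sum True"

abbreviation corner_sum :: "(bool list \<Rightarrow> real) \<Rightarrow> bool list \<Rightarrow> real" where
  "corner_sum \<equiv> corner_sum_on (\<lambda>_. True)"

abbreviation corner_sum_adj :: "(bool list \<Rightarrow> real) \<Rightarrow> bool list \<Rightarrow> real" where
  "corner_sum_adj \<equiv> exchange_sum False (\<lambda>_. True)"

lemma corner_sum_on_Cons:
  "corner_sum_on P f (x # l) =
     (if x \<and> l \<noteq> [] \<and> \<not> hd l \<and> P (length (tl l))
      then area_sign (tl l) * f (False # True # tl l) else 0) +
     corner_sum_on P (\<lambda>t. f (x # t)) l"
  by (cases l) (simp_all cong: if_cong)

lemma corner_sum_adj_Cons:
  "corner_sum_adj f (x # l) =
     (if \<not> x \<and> l \<noteq> [] \<and> hd l then area_sign (tl l) * f (True # False # tl l) else 0) +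
     corner_sum_adj (\<lambda>t. f (x # t)) l"
  by (cases l) (simp_all cong: if_cong)

lemma exchange_sum_cong:
  assumes "\<And>t. corner_exchange b P l t \<Longrightarrow> f t = g t"
  shows "exchange_sum b P f l = exchange_sum b P g l"
  using assms
proof (induction b P f l arbitrary: g rule: exchange_sum.induct)
  case (1 b P f x y s)
  have "exchange_sum b P (\<lambda>t. f (x # t)) (y # s) = exchange_sum b P (\<lambda>t. g (x # t)) (y # s)"
    by (rule "1.IH") (intro "1.prems" corner_exchange_Cons)
  moreover have "f ((\<not> b) # b # s) = g ((\<not> b) # b # s)" if "x = b" "y = (\<not> b)" "P (length s)"
    by (rule "1.prems") (use that in \<open>simp add: corner_exchange_hd\<close>)
  ultimately show ?case by simp
qed auto

lemma exchange_sum_cmult: "exchange_sum b P (\<lambda>t. c * f t) l = c * exchange_sum b P f l"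
  by (induction b P f l rule: exchange_sum.induct) (auto simp: algebra_simps)

lemma exchange_sum_0 [simp]: "exchange_sum b P (\<lambda>t. 0) l = 0"
  using exchange_sum_cmult[of b P 0 "\<lambda>_. 0"] by simp

lemma exchange_sum_add:
  "exchange_sum b P (\<lambda>t. f t + g t) l = exchange_sum b P f l + exchange_sum b P g l"
proof (induction b P f l arbitrary: g rule: exchange_sum.induct)
  case (1 b P f x y s)
  show ?case using 1[of "\<lambda>t. g (x # t)"] by (simp add: distrib_left)
qed auto

lemma exchange_sum_sum:
  "exchange_sum b P (\<lambda>t. \<Sum>i\<in>I. f i t) l = (\<Sum>i\<in>I. exchange_sum b P (f i) l)"
  by (induction I rule: infinite_finite_induct) (simp_all add: exchange_sum_add)

lemma exchange_sum_neq_0: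
  assumes "exchange_sum b P f l \<noteq> 0"
  obtains t where "corner_exchange b P l t" "f t \<noteq> 0"
  using assms exchange_sum_cong[of b P l f "\<lambda>_. 0"] by auto

lemma exchange_sum_split:
  "exchange_sum b (\<lambda>_. True) f l = exchange_sum b P f l + exchange_sum b (\<lambda>n. \<not> P n) f l"
  by (induction b P f l rule: exchange_sum.induct) auto

lemma corner_sum_on_area_sign:
  "corner_sum_on P (\<lambda>t. area_sign t * f t) l = - area_sign l * corner_sum_on P f l"
proof -
  have "corner_sum_on P (\<lambda>t. area_sign t * f t) l = corner_sum_on P (\<lambda>t. - area_sign l * f t) l"
    by (intro exchange_sum_cong) (simp add: area_sign_def corner_removal_measures)
  then show ?thesis by (simp only: exchange_sum_cmult)
qed

lemma corner_sum_adj_area_sign: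
  "corner_sum_adj (\<lambda>t. c (length t) * (area_sign (True # t) * f t)) l =
     - c (length l) * (area_sign (True # l) * corner_sum_adj f l)"
proof -
  have "corner_sum_adj (\<lambda>t. c (length t) * (area_sign (True # t) * f t)) l =
      corner_sum_adj (\<lambda>t. (- c (length l) * area_sign (True # l)) * f t) l"
    by (intro exchange_sum_cong)
      (simp add: corner_exchange_False_iff area_sign_def horiz_sign_def corner_removal_measures)
  then show ?thesis by (simp only: exchange_sum_cmult mult.assoc)
qed

definition words :: "nat \<Rightarrow> bool list set" where
  "words n = {l. length l = n}"

lemma finite_words [simp]: "finite (words n)"
  using finite_lists_length_eq[of "UNIV :: bool set" n] by (simp add: words_def)

lemma mem_words [simp]: "l \<in> words n \<longleftrightarrow> length l = n"
  by (simp add: words_def)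

lemma words_0 [simp]: "words 0 = {[]}"
  by (auto simp: words_def)

lemma sum_words_Suc:
  "(\<Sum>l\<in>words (Suc n). f l) = (\<Sum>l\<in>words n. f (True # l)) + (\<Sum>l\<in>words n. f (False # l))"
proof -
  have "words (Suc n) = Cons True ` words n \<union> Cons False ` words n"
    by (auto simp: words_def length_Suc_conv)
  moreover have "Cons True ` words n \<inter> Cons False ` words n = {}"
    by auto
  ultimately show ?thesis
    by (simp add: sum.union_disjoint sum.reindex)
qed

lemma corner_sum_adjoint:
  "(\<Sum>l\<in>words n. f l * corner_sum g l) = (\<Sum>l\<in>words n. corner_sum_adj f l * g l)"
proof (induction n arbitrary: f g)
  case (Suc n)
  have "(\<Sum>l\<in>words n. f (True # l) *
        (if l \<noteq> [] \<and> \<not> hd l then area_sign (tl l) * g (False # True # tl l) else 0)) =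
      (\<Sum>l\<in>words n. (if l \<noteq> [] \<and> hd l then area_sign (tl l) * f (True # False # tl l) else 0) *
        g (False # l))"
    by (cases n) (simp_all add: sum_words_Suc algebra_simps)
  then show ?case
    using Suc.IH[of "\<lambda>t. f (True # t)" "\<lambda>t. g (True # t)"]
      Suc.IH[of "\<lambda>t. f (False # t)" "\<lambda>t. g (False # t)"]
    by (simp add: sum_words_Suc corner_sum_on_Cons corner_sum_adj_Cons
        distrib_left distrib_right sum.distrib)
qed simp

section \<open>Strip kernels\<close>

type_synonym kernel = "bool list \<Rightarrow> bool list \<Rightarrow> real"

text \<open>
  The first word of a kernel is the inner shape and the second the outer one. The flag \<open>d\<close> tells
  whether the skew shape has a square on the diagonal where both words begin.
\<close>

definition relative_sign :: "bool \<Rightarrow> kernel" where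
  "relative_sign d m l = (if d then - horiz_sign l else 1) * area_sign l * area_sign m"

definition commutator :: "bool \<Rightarrow> kernel \<Rightarrow> kernel" where
  "commutator d K m l =
     corner_sum_adj (K m) l + relative_sign d m l * corner_sum (\<lambda>t. K t l) m"

definition initial_moves :: "bool \<Rightarrow> kernel \<Rightarrow> kernel" where
  "initial_moves d K m l =
     (case l of False # True # l' \<Rightarrow> area_sign l' * K m (True # False # l') | _ \<Rightarrow> 0) +
     relative_sign d m l *
       (case m of True # False # m' \<Rightarrow> area_sign m' * K (False # True # m') l | _ \<Rightarrow> 0)"

text \<open>
  The kernels below are supported on skew shapes without a \<open>2 \<times> 2\<close> square. The weights \<open>\<alpha>\<close>, \<open>\<beta>\<close>
  and \<open>\<gamma>\<close> are those of a square that begins a component or continues one downwards or to the left,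
  and the sign of \<open>r\<close> alternates along the squares.
\<close>

context
  fixes \<alpha> :: "nat \<Rightarrow> real \<Rightarrow> real" and \<beta> \<gamma> :: "real \<Rightarrow> real"
begin

fun strip_kernel :: "bool \<Rightarrow> real \<Rightarrow> kernel" where
  "strip_kernel d r [] [] = of_bool (\<not> d)"
| "strip_kernel False r (a # m) (b # l) =
     (if a = b then strip_kernel False r m l
      else if b then \<alpha> (length l) r * (area_sign (True # l) * strip_kernel True (- r) m l)
      else 0)"
| "strip_kernel True r (a # m) (b # l) =
     (if a = b
      then (if a then \<beta> r else \<gamma> r) * (area_sign (True # l) * strip_kernel True (- r) m l)
      else if a then strip_kernel False r m l
      else 0)"
| "strip_kernel _ _ _ _ = 0"

lemma strip_kernel_refl: "strip_kernel False r m m = 1"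
  by (induction m) auto

lemma strip_kernel_neq_0:
  "strip_kernel d r m l \<noteq> 0 \<Longrightarrow>
     horiz l = horiz m + of_bool d \<and> area m \<le> area l + (if d then horiz l else 0)"
  by (induction d r m l rule: strip_kernel.induct) (auto split: if_splits)

lemma commutator_Cons_False:
  assumes "horiz_sign (a # m) = horiz_sign (b # l)"
  shows "commutator False (strip_kernel False r) (a # m) (b # l) =
     initial_moves False (strip_kernel False r) (a # m) (b # l) +
     (if a = b then commutator False (strip_kernel False r) m l
      else if b then
        - \<alpha> (length l) r * (area_sign (True # l) * commutator True (strip_kernel True (- r)) m l)
      else 0)"
  using assms corner_sum_adj_area_sign[of "\<lambda>n. \<alpha> n r" "strip_kernel True (- r) m" l]
  by (cases a; cases b)
    (simp_all add: commutator_def initial_moves_def relative_sign_def corner_sum_on_Cons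
      corner_sum_adj_Cons exchange_sum_cmult algebra_simps split: list.split bool.split)

lemma commutator_Cons_True:
  assumes "horiz_sign (a # m) = - horiz_sign (b # l)"
  shows "commutator True (strip_kernel True r) (a # m) (b # l) =
     initial_moves True (strip_kernel True r) (a # m) (b # l) +
     (if a = b then
        - (if a then \<beta> r else \<gamma> r) *
          (area_sign (True # l) * commutator True (strip_kernel True (- r)) m l)
      else if a then commutator False (strip_kernel False r) m l
      else 0)"
  using assms corner_sum_adj_area_sign[of "\<lambda>_. \<beta> r" "strip_kernel True (- r) m" l]
    corner_sum_adj_area_sign[of "\<lambda>_. \<gamma> r" "strip_kernel True (- r) m" l]
  by (cases a; cases b)
    (simp_all add: commutator_def initial_moves_def relative_sign_def corner_sum_on_Cons
      corner_sum_adj_Cons exchange_sum_cmult algebra_simps split: list.split bool.split)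

end

text \<open>
  The signed number of ways to add a horizontal strip, with weight \<open>X\<close> per square, and then a
  vertical one; the sum over the intermediate shape is already carried out.
\<close>

definition hv_kernel :: "real \<Rightarrow> bool \<Rightarrow> real \<Rightarrow> kernel" where
  "hv_kernel X = strip_kernel (\<lambda>_ r. X + r) (\<lambda>r. r) (\<lambda>_. X)"

lemma hv_kernel_simps [simp]:
  "hv_kernel X d r [] [] = of_bool (\<not> d)"
  "hv_kernel X False r (a # m) (b # l) =
     (if a = b then hv_kernel X False r m l
      else if b then (X + r) * (area_sign (True # l) * hv_kernel X True (- r) m l)
      else 0)"
  "hv_kernel X True r (a # m) (b # l) =
     (if a = b then (if a then r else X) * (area_sign (True # l) * hv_kernel X True (- r) m l)
      else if a then hv_kernel X False r m l
      else 0)"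
  by (simp_all add: hv_kernel_def)

lemmas hv_commutator_Cons =
  commutator_Cons_False[where \<alpha> = "\<lambda>_ r. X + r" and \<beta> = "\<lambda>r. r" and \<gamma> = "\<lambda>_. X",
    folded hv_kernel_def]
  commutator_Cons_True[where \<alpha> = "\<lambda>_ r. X + r" and \<beta> = "\<lambda>r. r" and \<gamma> = "\<lambda>_. X",
    folded hv_kernel_def]
  for X :: real

text \<open>
  For words of shapes in a large box only the case \<open>\<not> d\<close> and \<open>\<not> hd l\<close> matters, where the
  commutator is a multiple of the kernel; the other cases occur on suffixes.
\<close>

lemma hv_commutator:
  assumes "length m = length l" "m \<noteq> []" "last m" "last l"
    "horiz_sign m = (if d then - horiz_sign l else horiz_sign l)"
  shows "commutator d (hv_kernel X d r) m l =
    (if d then X * horiz_sign l * (area_sign l * area_sign m * hv_kernel X True r m l -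
        hv_kernel X True (- r) m l) - r * hv_kernel X True r m l
     else (if hd l then (X + r) * horiz_sign m * hv_kernel X True (- r) m (False # tl l) else 0) -
       (r + area_sign l * area_sign m * X) * hv_kernel X False r m l)"
  using assms
proof (induction m l arbitrary: d r rule: list_induct2)
  case (Cons a m b l)
  show ?case
  proof (cases "m = []")
    case True
    then show ?thesis
      using Cons by (cases d) (auto simp: commutator_def)
  next
    case False
    then obtain a' m' b' l' where eqs: "m = a' # m'" "l = b' # l'"
      using Cons.hyps by (cases m; cases l) auto
    have IH: "horiz_sign m = horiz_sign l \<Longrightarrow> commutator False (hv_kernel X False r) m l =
        (if hd l then (X + r) * horiz_sign m * hv_kernel X True (- r) m (False # tl l) else 0) -
        (r + area_sign l * area_sign m * X) * hv_kernel X False r m l"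
      "horiz_sign m = - horiz_sign l \<Longrightarrow> commutator True (hv_kernel X True (- r)) m l =
        X * horiz_sign l * (area_sign l * area_sign m * hv_kernel X True (- r) m l -
        hv_kernel X True r m l) + r * hv_kernel X True (- r) m l"
      using Cons.IH[of False r] Cons.IH[of True "- r"] Cons.prems eqs by auto
    show ?thesis
      using Cons.prems IH hv_commutator_Cons[of a m b l X r] unfolding eqs
      by (cases d; cases a; cases b; cases a'; cases b';
          simp add: initial_moves_def relative_sign_def) (simp_all add: algebra_simps)
  qed
qed simp

text \<open>
  The squares of odd content are black. In words of even length their corners are followed by
  words of even length.
\<close>

definition black_kernel :: "real \<Rightarrow> bool \<Rightarrow> kernel" where
  "black_kernel w d = strip_kernel (\<lambda>n _. if odd n then w else 0) (\<lambda>_. 0) (\<lambda>_. 0) d 0"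

lemma black_kernel_simps [simp]:
  "black_kernel w d [] [] = of_bool (\<not> d)"
  "black_kernel w False (a # m) (b # l) =
     (if a = b then black_kernel w False m l
      else if b \<and> odd (length l) then w * (area_sign (True # l) * black_kernel w True m l)
      else 0)"
  "black_kernel w True (a # m) (b # l) = (if a \<and> \<not> b then black_kernel w False m l else 0)"
  by (simp_all add: black_kernel_def)

lemmas black_commutator_Cons =
  commutator_Cons_False[where \<alpha> = "\<lambda>n _. if odd n then w else 0" and \<beta> = "\<lambda>_. 0" and \<gamma> = "\<lambda>_. 0"
      and r = 0, unfolded minus_zero, folded black_kernel_def]
  commutator_Cons_True[where \<alpha> = "\<lambda>n _. if odd n then w else 0" and \<beta> = "\<lambda>_. 0" and \<gamma> = "\<lambda>_. 0"
      and r = 0, unfolded minus_zero, folded black_kernel_def]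
  for w :: real

lemma black_commutator:
  assumes w: "w = 2 * c" and "length m = length l" "d \<longrightarrow> odd (length m)"
    "horiz_sign m = (if d then - horiz_sign l else horiz_sign l)"
  shows "commutator d (black_kernel w d) m l =
    c * ((if odd (length m) \<and> \<not> d \<and> \<not> hd m then - horiz_sign m else horiz_sign m) -
      relative_sign d m l) * black_kernel w d m l"
  using assms(2-)
proof (induction m l arbitrary: d rule: list_induct2)
  case Nil
  then show ?case
    by (simp add: commutator_def relative_sign_def)
next
  case (Cons a m b l)
  show ?case
  proof (cases "m = []")
    case True
    then show ?thesis
      using Cons by (cases d; cases a; cases b; simp add: commutator_def relative_sign_def)
  next
    case False
    then obtain a' m' b' l' where eqs: "m = a' # m'" "l = b' # l'"
      using Cons.hyps by (cases m; cases l) auto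
    have IH: "horiz_sign m = horiz_sign l \<Longrightarrow> commutator False (black_kernel w False) m l =
        c * ((if odd (length m) \<and> \<not> hd m then - horiz_sign m else horiz_sign m) -
          relative_sign False m l) * black_kernel w False m l"
      "odd (length m) \<Longrightarrow> horiz_sign m = - horiz_sign l \<Longrightarrow>
        commutator True (black_kernel w True) m l =
        c * (horiz_sign m - relative_sign True m l) * black_kernel w True m l"
      using Cons.IH[of False] Cons.IH[of True] by auto
    show ?thesis
      using Cons.hyps Cons.prems IH black_commutator_Cons[of a m b l w] unfolding eqs
      by (cases d; cases a; cases b; cases a'; cases b'; cases "even (length m')";
          simp add: initial_moves_def relative_sign_def) (simp_all add: w algebra_simps)
  qed
qed

section \<open>Action of the kernels on the sign-imbalances\<close>

definition box_words :: "nat \<Rightarrow> bool list set" where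
  "box_words N = {l. length l = 2 * N \<and> horiz l = N}"

definition empty_word :: "nat \<Rightarrow> bool list" where
  "empty_word N = replicate N False @ replicate N True"

primrec imbalance :: "nat \<Rightarrow> nat \<Rightarrow> bool list \<Rightarrow> real" where
  "imbalance N 0 l = of_bool (l = empty_word N)"
| "imbalance N (Suc n) l = corner_sum (imbalance N n) l"

lemma box_words_subset_words: "box_words N \<subseteq> words (2 * N)"
  by (auto simp: box_words_def words_def)

lemma empty_word_in_box_words: "empty_word N \<in> box_words N"
  by (simp add: box_words_def empty_word_def)

lemma area_empty_word [simp]: "area (empty_word N) = 0"
  by (simp add: empty_word_def area_append)

lemma area_0_word:
  "area l = 0 \<Longrightarrow> l = replicate (horiz l) False @ replicate (length l - horiz l) True"
proof (induction l)
  case (Cons b l)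
  then show ?case using horiz_le_length[of l] by (cases b) (auto simp: Suc_diff_le)
qed simp

lemma box_words_area_0:
  assumes "l \<in> box_words N"
  shows "area l = 0 \<longleftrightarrow> l = empty_word N"
proof
  assume "area l = 0"
  from area_0_word[OF this] show "l = empty_word N"
    using assms by (simp add: box_words_def empty_word_def)
qed simp

lemma box_words_small_area:
  assumes "l \<in> box_words N" "area l < N"
  shows "\<not> hd l" "last l"
proof -
  from assms have "l \<noteq> []"
    by (auto simp: box_words_def)
  then show "\<not> hd l"
    using assms by (cases l) (auto simp: box_words_def split: if_splits)
  show "last l"
  proof (rule ccontr)
    assume "\<not> last l"
    with \<open>l \<noteq> []\<close> obtain k where "l = k @ [False]"
      by (metis append_butlast_last_id)
    then show False
      using assms by (auto simp: box_words_def area_append)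
  qed
qed

lemma corner_removal_box_words:
  assumes "corner_removal P l t"
  shows "t \<in> box_words N \<longleftrightarrow> l \<in> box_words N"
  using corner_removal_measures[OF assms] by (simp add: box_words_def)

lemma imbalance_neq_0: "imbalance N n l \<noteq> 0 \<Longrightarrow> l \<in> box_words N \<and> area l = n"
proof (induction n arbitrary: l)
  case 0
  then show ?case
    by (simp add: empty_word_in_box_words split: if_splits)
next
  case (Suc n)
  then obtain t where "corner_removal (\<lambda>_. True) l t" "imbalance N n t \<noteq> 0"
    by (auto elim: exchange_sum_neq_0)
  with Suc.IH[of t] show ?case
    using corner_removal_box_words[of _ l t] by (simp add: corner_removal_measures)
qed

primrec ladder_coeff :: "(real \<Rightarrow> real) \<Rightarrow> nat \<Rightarrow> nat \<Rightarrow> real" where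
  "ladder_coeff \<kappa> 0 a = of_bool (a = 0)"
| "ladder_coeff \<kappa> (Suc n) a =
     \<kappa> ((- 1) ^ (n + a)) * ladder_coeff \<kappa> n a -
     (- 1) ^ (n + a) * (case a of 0 \<Rightarrow> 0 | Suc a' \<Rightarrow> ladder_coeff \<kappa> n a')"

lemma ladder_coeff_eq_0: "n < a \<Longrightarrow> ladder_coeff \<kappa> n a = 0"
  by (induction n arbitrary: a) (auto split: nat.split)

lemma ladder_coeff_one_minus: "ladder_coeff (\<lambda>s. c * (1 - s)) n a = of_bool (a = n)"
proof (induction n arbitrary: a)
  case (Suc n)
  consider "a = n" | "a = Suc n" | "a \<noteq> n" "a \<noteq> Suc n"
    by blast
  then show ?case
    unfolding ladder_coeff.simps(2) Suc.IH by cases (auto split: nat.split)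
qed simp

locale ladder_kernel =
  fixes N :: nat and K :: kernel and \<kappa> :: "real \<Rightarrow> real"
  assumes refl: "K m m = 1"
    and neq_0: "K m l \<noteq> 0 \<Longrightarrow> horiz l = horiz m \<and> area m \<le> area l"
    and ladder: "\<lbrakk>m \<in> box_words N; l \<in> box_words N; area m < N; area l < N\<rbrakk> \<Longrightarrow>
      corner_sum_adj (K m) l + area_sign l * area_sign m * corner_sum (\<lambda>t. K t l) m =
      \<kappa> (area_sign l * area_sign m) * K m l"
begin

definition kernel_imbalance :: "nat \<Rightarrow> bool list \<Rightarrow> real" where
  "kernel_imbalance n m = (\<Sum>l\<in>words (2 * N). K m l * imbalance N n l)"

lemma kernel_imbalance_0: "length m = 2 * N \<Longrightarrow> kernel_imbalance 0 m = imbalance N 0 m"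
proof -
  assume m: "length m = 2 * N"
  have "kernel_imbalance 0 m = K m (empty_word N)"
    using empty_word_in_box_words box_words_subset_words
    by (simp add: kernel_imbalance_def of_bool_def if_distrib sum.delta subset_iff cong: if_cong)
  moreover have "m = empty_word N" if "K m (empty_word N) \<noteq> 0"
  proof -
    have "m \<in> box_words N" "area m = 0"
      using neq_0[OF that] m empty_word_in_box_words[of N] by (auto simp: box_words_def)
    then show ?thesis by (simp add: box_words_area_0)
  qed
  ultimately show ?thesis
    using refl by auto
qed

lemma kernel_imbalance_eq_0:
  assumes "length m = 2 * N" "\<not> (m \<in> box_words N \<and> area m \<le> n)"
  shows "kernel_imbalance n m = 0"
proof -
  have "K m l = 0" if "imbalance N n l \<noteq> 0" for l
    using assms neq_0[of m l] imbalance_neq_0[OF that]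
    by (cases "K m l = 0") (auto simp: box_words_def)
  then show ?thesis
    unfolding kernel_imbalance_def by (intro sum.neutral) auto
qed

lemma kernel_imbalance_Suc:
  assumes m: "m \<in> box_words N" "area m \<le> Suc n" and n: "Suc n < N"
  shows "kernel_imbalance (Suc n) m =
    \<kappa> ((- 1) ^ (n + area m)) * kernel_imbalance n m -
    (- 1) ^ (n + area m) * corner_sum (kernel_imbalance n) m"
proof -
  let ?s = "(- 1) ^ (n + area m) :: real"
  have adj_term: "corner_sum_adj (K m) l * imbalance N n l =
      \<kappa> ?s * (K m l * imbalance N n l) - ?s * corner_sum (\<lambda>t. K t l * imbalance N n l) m" for l
  proof (cases "imbalance N n l = 0")
    case False
    then have l: "l \<in> box_words N" "area l = n"
      by (auto dest: imbalance_neq_0)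
    have s: "area_sign l * area_sign m = ?s"
      by (simp add: area_sign_def l power_add)
    from ladder[OF m(1) l(1)] m(2) n l(2)
    have adj: "corner_sum_adj (K m) l = \<kappa> ?s * K m l - ?s * corner_sum (\<lambda>t. K t l) m"
      unfolding s by simp
    have "corner_sum (\<lambda>t. K t l * imbalance N n l) m = imbalance N n l * corner_sum (\<lambda>t. K t l) m"
      by (simp add: mult.commute flip: exchange_sum_cmult)
    then show ?thesis
      unfolding adj by (simp add: algebra_simps)
  qed simp
  have "kernel_imbalance (Suc n) m = (\<Sum>l\<in>words (2 * N). corner_sum_adj (K m) l * imbalance N n l)"
    by (simp add: kernel_imbalance_def corner_sum_adjoint)
  also have "\<dots> = \<kappa> ?s * kernel_imbalance n m - ?s * corner_sum (kernel_imbalance n) m"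
    unfolding adj_term kernel_imbalance_def
    by (simp add: sum_subtractf exchange_sum_sum flip: sum_distrib_left)
  finally show ?thesis .
qed

lemma kernel_imbalance_eq:
  "n < N \<Longrightarrow> length m = 2 * N \<Longrightarrow>
     kernel_imbalance n m = ladder_coeff \<kappa> n (area m) * imbalance N (area m) m"
proof (induction n arbitrary: m)
  case 0
  then show ?case
    by (cases "area m = 0") (auto simp: kernel_imbalance_0)
next
  case (Suc n)
  show ?case
  proof (cases "m \<in> box_words N \<and> area m \<le> Suc n")
    case False
    then have "ladder_coeff \<kappa> (Suc n) (area m) * imbalance N (area m) m = 0"
      using ladder_coeff_eq_0[of "Suc n" "area m" \<kappa>] imbalance_neq_0[of N "area m" m] by auto
    with False show ?thesis
      using kernel_imbalance_eq_0 Suc.prems by simp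
  next
    case True
    have "corner_sum (kernel_imbalance n) m =
        corner_sum (\<lambda>t. ladder_coeff \<kappa> n (area t) * imbalance N (area t) t) m"
      using Suc by (intro exchange_sum_cong) (simp add: corner_removal_measures)
    also have "\<dots> = (case area m of 0 \<Rightarrow> 0 | Suc a \<Rightarrow> ladder_coeff \<kappa> n a) * imbalance N (area m) m"
    proof (cases "area m")
      case 0
      then have "corner_sum (\<lambda>t. ladder_coeff \<kappa> n (area t) * imbalance N (area t) t) m =
          corner_sum (\<lambda>_. 0) m"
        by (intro exchange_sum_cong) (simp add: corner_removal_measures(3))
      then show ?thesis
        by (simp add: 0)
    next
      case (Suc a)
      have "corner_sum (\<lambda>t. ladder_coeff \<kappa> n (area t) * imbalance N (area t) t) m =
          corner_sum (\<lambda>t. ladder_coeff \<kappa> n a * imbalance N a t) m"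
        using Suc by (intro exchange_sum_cong) (auto dest: corner_removal_measures(3))
      then show ?thesis
        by (simp add: Suc exchange_sum_cmult)
    qed
    finally show ?thesis
      using True Suc by (simp add: kernel_imbalance_Suc algebra_simps)
  qed
qed

end

lemma ladder_kernel_hv: "ladder_kernel N (hv_kernel X False 1) (\<lambda>s. - 1 - s * X)"
proof
  show "hv_kernel X False 1 m m = 1" for m
    by (simp add: hv_kernel_def strip_kernel_refl)
  show "horiz l = horiz m \<and> area m \<le> area l" if "hv_kernel X False 1 m l \<noteq> 0" for m l
    using strip_kernel_neq_0[OF that[unfolded hv_kernel_def]] by simp
next
  fix m l
  assume "m \<in> box_words N" "l \<in> box_words N" "area m < N" "area l < N"
  moreover from this have "m \<noteq> []" "horiz_sign m = horiz_sign l"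
    by (auto simp: box_words_def horiz_sign_def)
  ultimately show "corner_sum_adj (hv_kernel X False 1 m) l +
      area_sign l * area_sign m * corner_sum (\<lambda>t. hv_kernel X False 1 t l) m =
      (- 1 - area_sign l * area_sign m * X) * hv_kernel X False 1 m l"
    using hv_commutator[of m l False X 1] box_words_small_area[of m N] box_words_small_area[of l N]
    by (simp add: box_words_def commutator_def relative_sign_def algebra_simps)
qed

lemma ladder_kernel_black:
  assumes "even N"
  shows "ladder_kernel N (black_kernel w False) (\<lambda>s. w / 2 * (1 - s))"
proof
  show "black_kernel w False m m = 1" for m
    by (simp add: black_kernel_def strip_kernel_refl)
  show "horiz l = horiz m \<and> area m \<le> area l" if "black_kernel w False m l \<noteq> 0" for m l
    using strip_kernel_neq_0[OF that[unfolded black_kernel_def]] by simp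
next
  fix m l
  assume "m \<in> box_words N" "l \<in> box_words N"
  moreover from this have "horiz_sign m = 1" "horiz_sign l = 1"
    using assms by (auto simp: box_words_def horiz_sign_def)
  ultimately show "corner_sum_adj (black_kernel w False m) l +
      area_sign l * area_sign m * corner_sum (\<lambda>t. black_kernel w False t l) m =
      w / 2 * (1 - area_sign l * area_sign m) * black_kernel w False m l"
    using black_commutator[of w "w / 2" m l False]
    by (simp add: box_words_def commutator_def relative_sign_def)
qed

lemma sum_hv_kernel_imbalance:
  assumes "n < N" "length m = 2 * N" "imbalance N (area m) m = 0"
  shows "(\<Sum>l\<in>words (2 * N). hv_kernel X False 1 m l * imbalance N n l) = 0"
  using ladder_kernel.kernel_imbalance_eq[OF ladder_kernel_hv assms(1,2)] assms(3)
  by (simp add: ladder_kernel.kernel_imbalance_def[OF ladder_kernel_hv])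

lemma sum_black_kernel_imbalance:
  assumes "even N" "n < N" "length m = 2 * N"
  shows "(\<Sum>l\<in>words (2 * N). black_kernel w False m l * imbalance N n l) = imbalance N n m"
proof -
  note ladder = ladder_kernel_black[OF assms(1), of w]
  have "(\<Sum>l\<in>words (2 * N). black_kernel w False m l * imbalance N n l) =
      of_bool (area m = n) * imbalance N (area m) m"
    using ladder_kernel.kernel_imbalance_eq[OF ladder assms(2,3)]
    unfolding ladder_kernel.kernel_imbalance_def[OF ladder] ladder_coeff_one_minus .
  then show ?thesis
    using imbalance_neq_0[of N n m] by auto
qed

section \<open>Black and white squares\<close>

lemma corner_sum_on_Cons_not:
  "\<not> P (length l - 1) \<Longrightarrow> corner_sum_on P f (x # l) = corner_sum_on P (\<lambda>t. f (x # t)) l"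
  by (simp add: corner_sum_on_Cons)

lemma corner_sum_on_Cons_Cons:
  assumes "P (length l)" "\<And>n. P n \<Longrightarrow> \<not> P (Suc n)"
  shows "corner_sum_on P f (x # y # l) =
    of_bool (x \<and> \<not> y) * (area_sign l * f (False # True # l)) +
    corner_sum_on P (\<lambda>t. f (x # y # t)) l"
  using assms(1) assms(2)[of "length (tl l)"]
  by (cases l) (auto simp: corner_sum_on_Cons)

lemma corner_sum_on_squared:
  assumes P: "\<And>n. P n \<Longrightarrow> \<not> P (Suc n)"
  shows "corner_sum_on P (corner_sum_on P f) l = 0"
proof (induction l arbitrary: f rule: length_induct[case_names less])
  case (less l)
  consider "l = []" | x where "l = [x]" | (pair) x y s where "l = x # y # s"
    by (metis neq_Nil_conv)
  then show ?case
  proof cases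
    case (pair x y s)
    show ?thesis
    proof (cases "P (length s)")
      case True
      note expand = corner_sum_on_Cons_Cons[of P, OF _ P]
      have "corner_sum_on P (\<lambda>t. corner_sum_on P f (x # y # t)) s =
          corner_sum_on P (\<lambda>t. of_bool (x \<and> \<not> y) * (area_sign t * f (False # True # t)) +
            corner_sum_on P (\<lambda>u. f (x # y # u)) t) s"
        using True by (intro exchange_sum_cong expand) (simp add: corner_removal_measures)
      also have "\<dots> = - of_bool (x \<and> \<not> y) * area_sign s *
          corner_sum_on P (\<lambda>t. f (False # True # t)) s"
        using less pair by (simp add: exchange_sum_add exchange_sum_cmult corner_sum_on_area_sign)
      finally show ?thesis
        using True unfolding pair by (simp add: expand del: exchange_sum.simps)
    next
      case False
      then have "corner_sum_on P (corner_sum_on P f) l =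
          corner_sum_on P (\<lambda>t. corner_sum_on P f (x # t)) (y # s)"
        by (simp add: pair corner_sum_on_Cons_not)
      also have "\<dots> = corner_sum_on P (corner_sum_on P (\<lambda>t. f (x # t))) (y # s)"
        using False
        by (intro exchange_sum_cong) (simp add: corner_sum_on_Cons_not corner_removal_measures)
      finally show ?thesis
        using less pair by simp
    qed
  qed auto
qed

text \<open>
  For the word of a shape in a box of even side this is twice the number of white squares minus
  twice the number of black ones.
\<close>

primrec balance :: "bool list \<Rightarrow> int" where
  "balance [] = 0"
| "balance (b # l) = (if b then (- 1) ^ length l else 0) + balance l"

lemma balance_corner_removal:
  assumes "corner_removal (\<lambda>n. even n = c) l t"
  shows "balance t = balance l + (if c then 2 else - 2)"
proof -
  obtain p s where s: "even (length s) = c" "l = p @ True # False # s" "t = p @ False # True # s"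
    using assms by (auto simp: corner_exchange_def)
  have "balance (p @ q) - balance q = balance (p @ q') - balance q'"
    if "length q = length q'" for q q'
    using that by (induction p) auto
  from this[of "False # True # s" "True # False # s"] show ?thesis
    using s by (auto simp: minus_one_power_iff)
qed

lemma balance_replicate: "even k \<Longrightarrow> balance (replicate k b) = 0"
proof -
  have "balance (replicate (2 * j) b) = 0" for j
    by (induction j) auto
  then show "even k \<Longrightarrow> balance (replicate k b) = 0"
    by (auto elim!: evenE)
qed

lemma balance_empty_word:
  assumes "even N"
  shows "balance (empty_word N) = 0"
proof -
  have "balance (replicate k False @ q) = balance q" for k q
    by (induction k) auto
  then show ?thesis
    using assms by (simp add: empty_word_def balance_replicate)
qed

lemma corner_removal_empty_word:
  assumes "corner_removal P l (empty_word N)"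
  shows "\<exists>k. N = Suc k \<and> P k"
proof -
  obtain p s where s: "empty_word N = p @ False # True # s" "P (length s)"
    using assms by (auto simp: corner_exchange_def)
  have "area (p @ False # True # s) = 0" "horiz (p @ False # True # s) = N"
      "length (p @ False # True # s) = 2 * N"
    using empty_word_in_box_words[of N] unfolding s(1)[symmetric] by (simp_all add: box_words_def)
  then have "N = Suc (length s)"
    using horiz_le_length[of p] by (simp add: area_append)
  with s show ?thesis
    by blast
qed

lemma corner_sum_on_imbalance:
  assumes "even N"
  shows "corner_sum_on (\<lambda>k. even (k + n)) (imbalance N n) l = 0"
proof (induction n arbitrary: l)
  case 0
  show ?case
  proof (rule ccontr)
    assume "corner_sum_on (\<lambda>k. even (k + 0)) (imbalance N 0) l \<noteq> 0"
    then obtain t where "corner_removal even l t" "imbalance N 0 t \<noteq> 0"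
      by (auto elim: exchange_sum_neq_0)
    then show False
      using corner_removal_empty_word[of even l N] assms by (auto split: if_splits)
  qed
next
  case (Suc n)
  have "imbalance N (Suc n) = corner_sum_on (\<lambda>k. odd (k + n)) (imbalance N n)"
    using Suc exchange_sum_split[of True "imbalance N n" _ "\<lambda>k. even (k + n)"]
    by (simp add: fun_eq_iff)
  then show ?case
    using corner_sum_on_squared[of "\<lambda>k. odd (k + n)"] by simp
qed

lemma imbalance_Suc_corner_sum_on:
  assumes "even N"
  shows "imbalance N (Suc n) l = corner_sum_on (\<lambda>k. odd (k + n)) (imbalance N n) l"
  using corner_sum_on_imbalance[OF assms]
    exchange_sum_split[of True "imbalance N n" l "\<lambda>k. even (k + n)"]
  by simp

lemma balance_imbalance:
  assumes "even N"
  shows "imbalance N n l \<noteq> 0 \<Longrightarrow> balance l = 2 * of_bool (odd n)"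
proof (induction n arbitrary: l)
  case 0
  then show ?case
    using balance_empty_word[OF assms] by (simp split: if_splits)
next
  case (Suc n)
  from Suc.prems obtain t where t: "corner_removal (\<lambda>k. odd (k + n)) l t" "imbalance N n t \<noteq> 0"
    unfolding imbalance_Suc_corner_sum_on[OF assms] by (rule exchange_sum_neq_0)
  have "(\<lambda>k. odd (k + n)) = (\<lambda>k. even k = odd n)"
    by auto
  with t(1) have "balance t = balance l + (if odd n then 2 else - 2)"
    by (simp only: balance_corner_removal)
  then show ?case
    using Suc.IH[OF t(2)] by (simp split: if_splits)
qed

fun paired :: "bool list \<Rightarrow> bool" where
  "paired [] = True"
| "paired [_] = False"
| "paired (x # y # l) = (x = y \<and> paired l)"

lemma paired_even: "paired l \<Longrightarrow> even (length l) \<and> even (horiz l) \<and> even (area l)"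
  by (induction l rule: paired.induct) auto

lemma corner_sum_on_even_paired: "paired l \<Longrightarrow> corner_sum_on even f l = 0"
proof (induction l arbitrary: f rule: paired.induct)
  case (3 x y l)
  then show ?case
    using paired_even[of l] by (cases l) (auto simp: corner_sum_on_Cons)
qed auto

lemma imbalance_paired:
  assumes "even N" "paired l" "area l > 0"
  shows "imbalance N (area l) l = 0"
proof -
  obtain n where n: "area l = Suc n"
    using assms(3) gr0_implies_Suc by blast
  then have "odd n"
    using paired_even[OF assms(2)] by simp
  then show ?thesis
    by (simp add: n imbalance_Suc_corner_sum_on assms corner_sum_on_even_paired
        del: imbalance.simps(2))
qed

section \<open>Fourling bodies of boundary words\<close>

text \<open>
  In the word of a fourling shape both letters of each pair agree. The flag \<open>W\<close> tells whether the
  diagonal before the first pair meets the strip; the pairs of different letters alternately begin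
  and end a component of the strip.
\<close>

fun body_word :: "bool \<Rightarrow> bool list \<Rightarrow> bool list" where
  "body_word W (p # q # l) =
     (if p = q then p # p # body_word W l else W # W # body_word (\<not> W) l)"
| "body_word W _ = []"

text \<open>
  The weight \<open>x\<close> counts the squares of the strip in even columns, and \<open>w\<close> those black corners that
  may be removed.
\<close>

definition pair_weight :: "real \<Rightarrow> real \<Rightarrow> bool \<Rightarrow> bool \<Rightarrow> bool \<Rightarrow> bool list \<Rightarrow> real" where
  "pair_weight x w W p q l =
     (if p = q then if W \<and> \<not> p then x else 1
      else (if p \<and> \<not> W then x else 1) + (if p then w * area_sign (True # False # l) else 0))"

fun body_weight :: "real \<Rightarrow> real \<Rightarrow> bool \<Rightarrow> bool list \<Rightarrow> real" where
  "body_weight x w W [] = of_bool (\<not> W)"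
| "body_weight x w W [_] = 0"
| "body_weight x w W (p # q # l) =
     pair_weight x w W p q l * body_weight x w (if p = q then W else \<not> W) l"

lemma length_body_word: "even (length l) \<Longrightarrow> length (body_word W l) = length l"
  by (induction W l rule: body_word.induct) auto

lemma paired_body_word: "paired (body_word W l)"
  by (induction W l rule: body_word.induct) auto

lemma horiz_body_word:
  "even (length l) \<Longrightarrow> odd (horiz l) = W \<Longrightarrow> horiz l = horiz (body_word W l) + of_bool W"
  by (induction W l rule: body_word.induct) (auto split: if_splits)

primrec half_area :: "bool list \<Rightarrow> nat" where
  "half_area [] = 0"
| "half_area (b # l) = (if b then horiz l div 2 else 0) + half_area l"

lemma body_weight_half_area:
  assumes "even (length l)" "odd (horiz l) = W"
  shows "x ^ half_area (body_word W l) * body_weight x 0 W l =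
    x ^ (half_area l + (if W then horiz l div 2 else 0))"
  using assms
proof (induction W l rule: body_word.induct)
  case (1 W p q l)
  have "horiz l = horiz (body_word V l) + of_bool V" if "odd (horiz l) = V" for V
    using horiz_body_word[of l V] 1 that by simp
  then show ?case
    using 1 by (cases p; cases q; cases W) (auto simp: pair_weight_def power_add algebra_simps)
qed auto

definition parity_sign :: "int \<Rightarrow> real" where
  "parity_sign b = (if even b then 1 else - 1)"

lemma parity_sign_add_1 [simp]: "parity_sign (b + 1) = - parity_sign b"
  by (simp add: parity_sign_def)

lemma parity_sign_diff_1 [simp]: "parity_sign (b - 1) = - parity_sign b"
  by (simp add: parity_sign_def)

lemma parity_sign_mult_self [simp]:
  "parity_sign b * parity_sign b = 1"
  "parity_sign b * (parity_sign b * z) = z"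
  by (simp_all add: parity_sign_def)

definition colour_ratio :: "real \<Rightarrow> real \<Rightarrow> int \<Rightarrow> real" where
  "colour_ratio \<tau> X b =
     ((1 + X) * (1 - X)) powi (b div 2) * (if even b then 1 else \<tau> * (1 + X))"

lemma colour_ratio_add_1:
  assumes "\<tau> * \<tau> = 1" "X > 1"
  shows "colour_ratio \<tau> X (b + 1) = \<tau> * (1 + parity_sign b * X) * colour_ratio \<tau> X b"
proof (cases "even b")
  case True
  then show ?thesis
    by (simp add: colour_ratio_def parity_sign_def)
next
  case False
  then have "(b + 1) div 2 = b div 2 + 1"
    by presburger
  moreover have "(1 + X) * (1 - X) \<noteq> 0"
    using assms by simp
  ultimately have "colour_ratio \<tau> X (b + 1) =
      ((1 + X) * (1 - X)) powi (b div 2) * ((1 + X) * (1 - X))"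
    using False by (simp add: colour_ratio_def power_int_add_1)
  also have "\<dots> = (\<tau> * \<tau>) * \<dots>"
    by (simp add: assms)
  finally show ?thesis
    using False by (simp add: colour_ratio_def parity_sign_def)
qed

lemma hv_kernel_pair:
  assumes "r * r = 1" "horiz_sign (p # q # l) = (if W then - 1 else 1)"
  shows "hv_kernel X W r (a # a # D) (p # q # l) =
    (if a \<noteq> (if p = q then p else W) then 0
     else if p = q then (if W \<and> \<not> p then - (X * X) else 1) * hv_kernel X W r D l
     else if W then
       (if p then - (r * area_sign l) * hv_kernel X False (- r) D l else hv_kernel X False r D l)
     else (X + r) *
       (if p then - X * hv_kernel X True r D l else - area_sign l * hv_kernel X True (- r) D l))"
proof -
  have "r * (r * z) = z" for z
    using assms(1) by (simp flip: mult.assoc)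
  then show ?thesis
    using assms by (cases W; cases a; cases p; cases q) (simp_all add: algebra_simps)
qed

lemma colour_ratio_hv_kernel_pair:
  assumes \<tau>: "\<tau> * \<tau> = 1" and X: "X > 1"
    and sign: "horiz_sign (p # q # l) = (if W then - 1 else 1)"
    and \<tau>_eq: "\<tau> = parity_sign b * area_sign (p # q # l)"
  defines "c \<equiv> if p = q then b else b + of_bool q - of_bool W"
  shows "colour_ratio \<tau> X b * hv_kernel X W (parity_sign b) (a # a # D) (p # q # l) =
    of_bool (a = (if p = q then p else W)) * pair_weight (- (X * X)) (- (\<tau> * X)) W p q l *
    (colour_ratio \<tau> X c * hv_kernel X (if p = q then W else \<not> W) (parity_sign c) D l)"
proof -
  let ?r = "parity_sign b" and ?C = "colour_ratio \<tau> X"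
  note kernel = hv_kernel_pair[OF parity_sign_mult_self(1)[of b] sign, of X a D]
  consider (zero) "a \<noteq> (if p = q then p else W)" | (same) "a = p" "p = q"
    | (begin_white) "a = W" "\<not> W" "\<not> p" "q" | (begin_black) "a = W" "\<not> W" "p" "\<not> q"
    | (end_white) "a = W" "W" "\<not> p" "q" | (end_black) "a = W" "W" "p" "\<not> q"
    by metis
  then show ?thesis
  proof cases
    case begin_white
    then have "\<tau> = - (?r * area_sign l)"
      using sign \<tau>_eq by simp
    then have "\<tau> * (1 + ?r * X) = (X + ?r) * - area_sign l"
      by (simp add: algebra_simps)
    then have "?C c = (X + ?r) * - area_sign l * ?C b"
      using begin_white colour_ratio_add_1[OF \<tau> X, of b] by (simp add: c_def)
    then have "?C b * ((X + ?r) * (- area_sign l * k)) = ?C c * k" for k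
      by (simp only: ac_simps)
    then show ?thesis
      using begin_white unfolding kernel by (simp add: pair_weight_def c_def)
  next
    case begin_black
    then have l: "horiz_sign l = - 1" "\<tau> = ?r * area_sign l"
      using sign \<tau>_eq by simp_all
    then have "- (X * X) - \<tau> * X * area_sign l = - X * (X + ?r)"
      by (simp add: algebra_simps)
    then show ?thesis
      using begin_black l(1) unfolding kernel by (simp add: pair_weight_def c_def)
  next
    case end_black
    then have l: "horiz_sign l = 1" "\<tau> = - (?r * area_sign l)"
      using sign \<tau>_eq by simp_all
    then have "1 + \<tau> * X * area_sign l = 1 - ?r * X"
      by (simp add: algebra_simps)
    moreover have "?C b = \<tau> * (1 - ?r * X) * ?C c"
      using end_black colour_ratio_add_1[OF \<tau> X, of "b - 1"] by (simp add: c_def)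
    then have "?C b * (- (?r * area_sign l) * k) = (\<tau> * \<tau>) * ((1 - ?r * X) * (?C c * k))" for k
      unfolding l(2)[symmetric] by (simp only: ac_simps)
    ultimately show ?thesis
      using end_black l(1) \<tau> unfolding kernel by (simp add: pair_weight_def c_def)
  qed (unfold kernel, auto simp: pair_weight_def c_def)
qed

text \<open>
  Here \<open>b\<close> is the number of white minus black squares of the skew shape on the diagonals before
  the two words, and \<open>B\<close> the number on all diagonals.
\<close>

lemma hv_kernel_eq_body_weight:
  assumes \<tau>: "\<tau> * \<tau> = 1" and X: "X > 1"
  shows "paired D \<Longrightarrow> length D = length l \<Longrightarrow> horiz_sign l = (if W then - 1 else 1) \<Longrightarrow>
    \<tau> = parity_sign b * area_sign l \<Longrightarrow> balance l = 2 * (B - b) + of_bool W \<Longrightarrow>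
    colour_ratio \<tau> X b * hv_kernel X W (parity_sign b) D l =
    colour_ratio \<tau> X B * (of_bool (D = body_word W l) * body_weight (- (X * X)) (- (\<tau> * X)) W l)"
proof (induction D arbitrary: W b l rule: paired.induct)
  case 1
  then show ?case by (cases W) auto
next
  case (3 a a' D)
  then obtain p q l' where l: "l = p # q # l'" and len: "length D = length l'"
    by (metis "3.prems"(2) length_Cons length_Suc_conv nat.inject)
  have a': "a' = a" and D: "paired D" and even: "even (length l')"
    using 3 paired_even[of D] len by auto
  define V where "V = (if p = q then W else \<not> W)"
  define c where "c = (if p = q then b else b + of_bool q - of_bool W)"
  have "horiz_sign l' = (if V then - 1 else 1)" "\<tau> = parity_sign c * area_sign l'"
    "balance l' = 2 * (B - c) + of_bool V"
    using "3.prems"(3-5) even unfolding l V_def c_def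
    by (cases p; cases q; cases W; simp)+
  from "3.IH"[OF D len this]
  have IH: "colour_ratio \<tau> X c * hv_kernel X V (parity_sign c) D l' = colour_ratio \<tau> X B *
      (of_bool (D = body_word V l') * body_weight (- (X * X)) (- (\<tau> * X)) V l')" .
  have "colour_ratio \<tau> X b * hv_kernel X W (parity_sign b) (a # a # D) (p # q # l') =
      of_bool (a = (if p = q then p else W)) * pair_weight (- (X * X)) (- (\<tau> * X)) W p q l' *
      (colour_ratio \<tau> X c * hv_kernel X V (parity_sign c) D l')"
    using colour_ratio_hv_kernel_pair[OF \<tau> X] "3.prems"(3,4) unfolding l V_def c_def .
  also have "\<dots> = colour_ratio \<tau> X B * (of_bool (a # a # D = body_word W (p # q # l')) *
      body_weight (- (X * X)) (- (\<tau> * X)) W (p # q # l'))"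
    unfolding IH by (auto simp: V_def)
  finally show ?case
    by (simp only: l a')
qed auto

lemma black_kernel_pair:
  assumes "even (length l)"
  shows "black_kernel w False (a # a' # m) (b # b' # l) =
    (if a = b \<and> a' = b' then black_kernel w False m l
     else if \<not> a \<and> a' \<and> b \<and> \<not> b'
     then w * (area_sign (True # False # l) * black_kernel w False m l) else 0)"
  using assms by auto

lemma sum_body_weight_black_kernel:
  assumes "even (length l)"
  shows "(\<Sum>m\<in>words (length l). g (body_word W m) * body_weight x 0 W m * black_kernel w False m l) =
    g (body_word W l) * body_weight x w W l"
  using assms
proof (induction l arbitrary: g W rule: paired.induct)
  case (3 p q l)
  define V where "V = (if p = q then W else \<not> W)"
  define h where "h D = (if p = q then g (p # p # D) else g (W # W # D))" for D
  let ?f = "\<lambda>m. g (body_word W m) * body_weight x 0 W m * black_kernel w False m (p # q # l)"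
  let ?h = "\<lambda>m. h (body_word V m) * body_weight x 0 V m * black_kernel w False m l"
  let ?w = "if p \<and> \<not> q then w * area_sign (True # False # l) else 0"
  have "(\<Sum>m\<in>words (length (p # q # l)). ?f m) =
      (\<Sum>m\<in>words (length l). ?f (p # q # m)) +
      (if p \<and> \<not> q then \<Sum>m\<in>words (length l). ?f (False # True # m) else 0)"
    using 3(2) by (cases p; cases q) (simp_all add: sum_words_Suc black_kernel_pair)
  also have "(\<Sum>m\<in>words (length l). ?f (p # q # m)) =
      (\<Sum>m\<in>words (length l). pair_weight x 0 W p q l * ?h m)"
    by (intro sum.cong) (simp_all add: V_def h_def pair_weight_def)
  also have "(if p \<and> \<not> q then \<Sum>m\<in>words (length l). ?f (False # True # m) else 0) =
      (\<Sum>m\<in>words (length l). ?w * ?h m)"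
    using 3(2) by (simp add: V_def h_def pair_weight_def black_kernel_pair ac_simps)
  also have "(\<Sum>m\<in>words (length l). pair_weight x 0 W p q l * ?h m) + \<dots> =
      (pair_weight x 0 W p q l + ?w) * (\<Sum>m\<in>words (length l). ?h m)"
    by (simp only: sum_distrib_left[symmetric] distrib_right)
  also have "pair_weight x 0 W p q l + ?w = pair_weight x w W p q l"
    by (simp add: pair_weight_def)
  also have "(\<Sum>m\<in>words (length l). ?h m) = h (body_word V l) * body_weight x w V l"
    using 3 by simp
  finally show ?case
    by (simp add: V_def h_def)
qed auto

text \<open>Since the black corner sum maps the vector of sign-imbalances to itself, \<open>w\<close> is immaterial.\<close>

lemma sum_body_weight_imbalance_indep:
  assumes "even N" "n < N"
  shows "(\<Sum>l\<in>words (2 * N). of_bool (D = body_word W l) * body_weight x w W l * imbalance N n l) =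
    (\<Sum>l\<in>words (2 * N). of_bool (D = body_word W l) * body_weight x 0 W l * imbalance N n l)"
proof -
  let ?g = "\<lambda>l. of_bool (D = body_word W l) :: real"
  have "(\<Sum>l\<in>words (2 * N). ?g l * body_weight x w W l * imbalance N n l) =
      (\<Sum>l\<in>words (2 * N). \<Sum>m\<in>words (2 * N).
        ?g m * body_weight x 0 W m * black_kernel w False m l * imbalance N n l)"
  proof (rule sum.cong)
    fix l :: "bool list"
    assume "l \<in> words (2 * N)"
    then show "?g l * body_weight x w W l * imbalance N n l =
        (\<Sum>m\<in>words (2 * N).
          ?g m * body_weight x 0 W m * black_kernel w False m l * imbalance N n l)"
      using sum_body_weight_black_kernel[of l "\<lambda>D'. of_bool (D = D')" W x w]
      by (simp flip: sum_distrib_right)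
  qed simp
  also have "\<dots> = (\<Sum>m\<in>words (2 * N). ?g m * body_weight x 0 W m *
      (\<Sum>l\<in>words (2 * N). black_kernel w False m l * imbalance N n l))"
    by (subst sum.swap) (simp add: sum_distrib_left mult.assoc)
  also have "\<dots> = (\<Sum>m\<in>words (2 * N). ?g m * body_weight x 0 W m * imbalance N n m)"
    by (simp add: sum_black_kernel_imbalance assms)
  finally show ?thesis .
qed

lemma sum_body_weight_imbalance_eq_0:
  assumes N: "even N" "n < N" and D: "paired D" "length D = 2 * N" "area D > 0" and X: "X > 1"
  shows "(\<Sum>l\<in>words (2 * N).
    of_bool (D = body_word False l) * body_weight (- (X * X)) 0 False l * imbalance N n l) = 0"
proof -
  define \<tau> :: real where "\<tau> = (- 1) ^ n"
  define B :: int where "B = of_bool (odd n)"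
  let ?weight = "\<lambda>l. of_bool (D = body_word False l) * body_weight (- (X * X)) (- (\<tau> * X)) False l"
  have "\<tau> * \<tau> = 1"
    by (simp add: \<tau>_def flip: power_add)
  have "colour_ratio \<tau> X B * (?weight l * imbalance N n l) =
      hv_kernel X False 1 D l * imbalance N n l" if "l \<in> words (2 * N)" for l
  proof (cases "imbalance N n l = 0")
    case False
    then have l: "l \<in> box_words N" "area l = n" "balance l = 2 * B"
      using imbalance_neq_0 balance_imbalance[OF N(1)] by (auto simp: B_def)
    have "colour_ratio \<tau> X 0 * hv_kernel X False (parity_sign 0) D l =
        colour_ratio \<tau> X B * ?weight l"
      using l N D by (intro hv_kernel_eq_body_weight \<open>\<tau> * \<tau> = 1\<close> X)
        (auto simp: box_words_def horiz_sign_def area_sign_def parity_sign_def \<tau>_def)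
    then show ?thesis
      by (simp add: colour_ratio_def parity_sign_def)
  qed simp
  then have "colour_ratio \<tau> X B * (\<Sum>l\<in>words (2 * N). ?weight l * imbalance N n l) =
      (\<Sum>l\<in>words (2 * N). hv_kernel X False 1 D l * imbalance N n l)"
    unfolding sum_distrib_left by (intro sum.cong) auto
  also have "\<dots> = 0"
    using sum_hv_kernel_imbalance imbalance_paired N D by blast
  finally have "colour_ratio \<tau> X B * (\<Sum>l\<in>words (2 * N). ?weight l * imbalance N n l) = 0" .
  moreover have "colour_ratio \<tau> X B \<noteq> 0"
    using X by (cases "even n") (simp_all add: colour_ratio_def B_def \<tau>_def)
  ultimately have "(\<Sum>l\<in>words (2 * N). ?weight l * imbalance N n l) = 0"
    by simp
  then show ?thesis
    using sum_body_weight_imbalance_indep[OF N, of D False "- (X * X)" "- (\<tau> * X)"] by simp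
qed

lemma sum_fibre_eq_0_of_power_sums:
  fixes c :: "'a \<Rightarrow> 'b :: idom" and e :: "'a \<Rightarrow> nat"
  assumes "finite A" and inf: "infinite Y" and 0: "\<And>y. y \<in> Y \<Longrightarrow> (\<Sum>a\<in>A. c a * y ^ e a) = 0"
  shows "(\<Sum>a | a \<in> A \<and> e a = k. c a) = 0"
proof -
  define p where "p = (\<Sum>a\<in>A. monom (c a) (e a))"
  have "Y \<subseteq> {y. poly p y = 0}"
    using 0 by (auto simp: p_def poly_sum poly_monom)
  then have "p = 0"
    using inf poly_roots_finite[of p] finite_subset by blast
  then have "coeff p k = 0"
    by simp
  then show ?thesis
    using assms(1) by (simp add: p_def coeff_sum sum.inter_filter)
qed

lemma sum_imbalance_half_area_power:
  assumes N: "even N" "n < N" and D: "paired D" "length D = 2 * N" "area D > 0" and X: "X > 1"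
  shows "(\<Sum>l | l \<in> words (2 * N) \<and> body_word False l = D.
    imbalance N n l * (- (X * X)) ^ half_area l) = 0"
proof -
  let ?A = "{l. l \<in> words (2 * N) \<and> body_word False l = D}" and ?x = "- (X * X)"
  have "imbalance N n l * ?x ^ half_area l =
      ?x ^ half_area D * (body_weight ?x 0 False l * imbalance N n l)" if "l \<in> ?A" for l
  proof (cases "imbalance N n l = 0")
    case False
    then have "even (length l)" "even (horiz l)"
      using imbalance_neq_0[of N n l] N by (auto simp: box_words_def)
    then show ?thesis
      using body_weight_half_area[of l False ?x] that by simp
  qed simp
  then have "(\<Sum>l\<in>?A. imbalance N n l * ?x ^ half_area l) =
      ?x ^ half_area D * (\<Sum>l\<in>?A. body_weight ?x 0 False l * imbalance N n l)"
    unfolding sum_distrib_left by (intro sum.cong) auto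
  also have "(\<Sum>l\<in>?A. body_weight ?x 0 False l * imbalance N n l) =
      (\<Sum>l\<in>words (2 * N).
        of_bool (D = body_word False l) * body_weight ?x 0 False l * imbalance N n l)"
    by (rule sum.mono_neutral_cong_left) auto
  also have "\<dots> = 0"
    by (rule sum_body_weight_imbalance_eq_0[OF N D X])
  finally show ?thesis
    by simp
qed

lemma sum_imbalance_fixed_body:
  assumes N: "even N" "n < N" and D: "paired D" "length D = 2 * N" "area D > 0"
  shows "(\<Sum>l | l \<in> words (2 * N) \<and> body_word False l = D \<and> half_area l = k. imbalance N n l) = 0"
proof -
  let ?A = "{l. l \<in> words (2 * N) \<and> body_word False l = D}"
  have "(\<Sum>l | l \<in> ?A \<and> half_area l = k. imbalance N n l) = 0"
  proof (rule sum_fibre_eq_0_of_power_sums)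
    show "finite ?A"
      by (rule finite_subset[of _ "words (2 * N)"]) auto
    have "inj_on (\<lambda>X :: real. - (X * X)) {1<..}"
      by (intro inj_onI) (auto simp: square_eq_iff)
    then show "infinite ((\<lambda>X :: real. - (X * X)) ` {1<..})"
      by (simp add: finite_image_iff infinite_Ioi)
    show "(\<Sum>l\<in>?A. imbalance N n l * y ^ half_area l) = 0" if "y \<in> (\<lambda>X. - (X * X)) ` {1<..}" for y
      using that sum_imbalance_half_area_power[OF N D] by auto
  qed
  then show ?thesis
    by simp
qed

section \<open>Sign-imbalance by removal of corners\<close>

lemma finite_shape: "is_shape S \<Longrightarrow> finite S"
  unfolding is_shape_iff by blast

lemma shape_ge_1: "is_shape S \<Longrightarrow> (r, c) \<in> S \<Longrightarrow> 1 \<le> r \<and> 1 \<le> c"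
  unfolding is_shape_iff by blast

lemma shape_down_closed:
  "is_shape S \<Longrightarrow> (r, c) \<in> S \<Longrightarrow> 1 \<le> r' \<Longrightarrow> r' \<le> r \<Longrightarrow> 1 \<le> c' \<Longrightarrow> c' \<le> c \<Longrightarrow> (r', c') \<in> S"
  unfolding is_shape_iff by blast

definition precedes :: "square \<Rightarrow> square \<Rightarrow> bool" where
  "precedes p q \<longleftrightarrow> fst p < fst q \<or> fst p = fst q \<and> snd p < snd q"

definition inversions :: "square set \<Rightarrow> (square \<Rightarrow> nat) \<Rightarrow> (square \<times> square) set" where
  "inversions S T = {(p, q). p \<in> S \<and> q \<in> S \<and> precedes p q \<and> T q < T p}"

definition corners :: "square set \<Rightarrow> square set" where
  "corners S = {(r, c). (r, c) \<in> S \<and> (Suc r, c) \<notin> S \<and> (r, Suc c) \<notin> S}"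

definition signed_corner_sum :: "(square set \<Rightarrow> 'a) \<Rightarrow> square set \<Rightarrow> 'a::comm_ring_1" where
  "signed_corner_sum f S =
     (\<Sum>p\<in>corners S. (- 1) ^ card {q \<in> S. precedes p q} * f (S - {p}))"

lemma card_inversions_list:
  assumes "sorted_wrt precedes xs"
  shows "card {(i, j). i < j \<and> j < length xs \<and> T (xs ! j) < T (xs ! i)} =
    card (inversions (set xs) T)"
proof (rule bij_betw_same_card)
  have nth: "precedes (xs ! i) (xs ! j) \<longleftrightarrow> i < j" if "i < length xs" "j < length xs" for i j
    using assms that sorted_wrt_nth_less[OF assms, of i j] sorted_wrt_nth_less[OF assms, of j i]
    by (cases i j rule: linorder_cases) (auto simp: precedes_def)
  have inj: "i = j" if "i < length xs" "j < length xs" "xs ! i = xs ! j" for i j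
    using nth[of i j] nth[of j i] nth[of i i] that
    by (cases i j rule: linorder_cases) auto
  show "bij_betw (\<lambda>(i, j). (xs ! i, xs ! j))
      {(i, j). i < j \<and> j < length xs \<and> T (xs ! j) < T (xs ! i)} (inversions (set xs) T)"
    unfolding bij_betw_def
  proof
    show "inj_on (\<lambda>(i, j). (xs ! i, xs ! j))
        {(i, j). i < j \<and> j < length xs \<and> T (xs ! j) < T (xs ! i)}"
      by (auto simp: inj_on_def intro: inj)
    show "(\<lambda>(i, j). (xs ! i, xs ! j)) `
        {(i, j). i < j \<and> j < length xs \<and> T (xs ! j) < T (xs ! i)} = inversions (set xs) T"
    proof (intro equalityI subsetI)
      fix x
      assume "x \<in> inversions (set xs) T"
      then obtain i j where "i < length xs" "j < length xs" "x = (xs ! i, xs ! j)"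
        "precedes (xs ! i) (xs ! j)" "T (xs ! j) < T (xs ! i)"
        by (auto simp: inversions_def in_set_conv_nth)
      then show "x \<in> (\<lambda>(i, j). (xs ! i, xs ! j)) `
          {(i, j). i < j \<and> j < length xs \<and> T (xs ! j) < T (xs ! i)}"
        using nth[of i j] by (intro rev_image_eqI[of "(i, j)"]) auto
    qed (auto simp: inversions_def nth)
  qed
qed

lemma sorted_wrt_precedes_rows:
  "sorted_wrt precedes (concat (map (\<lambda>r. map (Pair r) [1..<Suc (f r)]) [a..<b]))"
proof (induction b)
  case (Suc b)
  have "sorted_wrt precedes (map (Pair b) [1..<Suc k])" for k
    by (simp add: sorted_wrt_map precedes_def del: upt_Suc)
  moreover have "precedes p q"
    if "p \<in> set (concat (map (\<lambda>r. map (Pair r) [1..<Suc (f r)]) [a..<b]))"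
      "q \<in> set (map (Pair b) [1..<Suc (f b)])" for p q
    using that by (auto simp: precedes_def simp del: upt_Suc)
  ultimately show ?case
    using Suc by (simp add: sorted_wrt_append upt_Suc[of a] del: upt_Suc)
qed simp

lemma shape_row_indices:
  assumes "is_shape S"
  shows "fst ` S = {1..card (fst ` S)}"
proof (rule initial_segment)
  show "finite (fst ` S)"
    using assms by (simp add: finite_shape)
  show "1 \<le> a" if "a \<in> fst ` S" for a
    using that shape_ge_1[OF assms] by auto
  show "b \<in> fst ` S" if a: "a \<in> fst ` S" and b: "1 \<le> b" "b \<le> a" for a b
  proof -
    obtain c where "(a, c) \<in> S"
      using a by auto
    then have "(b, c) \<in> S"
      using shape_down_closed[OF assms _ b] shape_ge_1[OF assms] by blast
    then show ?thesis
      by (rule image_eqI[rotated]) simp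
  qed
qed

lemma sgn_tableau_inversions:
  assumes "is_shape S"
  shows "sgn_tableau S T = (- 1) ^ card (inversions S T)"
proof -
  define xs where
    "xs = concat (map (\<lambda>r. map (Pair r) [1..<Suc (part S r)]) [1..<Suc (card (fst ` S))])"
  have "set xs = {(r, c). r \<in> fst ` S \<and> 1 \<le> c \<and> c \<le> part S r}"
    by (subst shape_row_indices[OF assms]) (auto simp: xs_def image_iff simp del: upt_Suc)
  also have "\<dots> = S"
    using shape_mem_iff[OF assms] by (force simp: image_iff)
  finally have "set xs = S" .
  moreover have "reading_word S T = map T xs"
    by (simp add: reading_word_def xs_def map_concat comp_def del: upt_Suc)
  moreover have "{(i, j). i < j \<and> j < length (map T xs) \<and> map T xs ! i > map T xs ! j} =
      {(i, j). i < j \<and> j < length xs \<and> T (xs ! j) < T (xs ! i)}"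
    by auto
  moreover have "sorted_wrt precedes xs"
    unfolding xs_def by (rule sorted_wrt_precedes_rows)
  ultimately show ?thesis
    using card_inversions_list[of xs T] by (simp add: sgn_tableau_def word_sign_def)
qed

lemma sign_imbalance_empty: "sign_imbalance {} = 1"
proof -
  have "SYT {} = {\<lambda>_. undefined}"
    by (auto simp: SYT_def bij_betw_def)
  moreover have "is_shape {}"
    by (simp add: is_shape_iff)
  ultimately show ?thesis
    by (simp add: sign_imbalance_def sgn_tableau_inversions inversions_def)
qed

lemma corner_maximal:
  assumes "is_shape S" "(r, c) \<in> corners S" "(r', c') \<in> S" "r \<le> r'" "c \<le> c'"
  shows "r' = r \<and> c' = c"
proof (rule ccontr)
  assume "\<not> (r' = r \<and> c' = c)"
  then have "Suc r \<le> r' \<or> Suc c \<le> c'"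
    using assms(4,5) by auto
  moreover have "1 \<le> r" "1 \<le> c" "(Suc r, c) \<notin> S" "(r, Suc c) \<notin> S"
    using assms(2) shape_ge_1[OF assms(1), of r c] by (auto simp: corners_def)
  ultimately show False
    using shape_down_closed[OF assms(1,3), of "Suc r" c]
      shape_down_closed[OF assms(1,3), of r "Suc c"] assms(4,5) by auto
qed

lemma is_shape_remove_corner:
  assumes S: "is_shape S" and p: "p \<in> corners S"
  shows "is_shape (S - {p})"
proof -
  obtain r c where rc: "p = (r, c)"
    by (cases p)
  have "(r', c') \<noteq> (r, c)"
    if "(i, j) \<in> S" "(i, j) \<noteq> (r, c)" "r' \<le> i" "c' \<le> j" for r' c' i j
    using corner_maximal[OF S p[unfolded rc] that(1)] that by auto
  then show ?thesis
    using S unfolding rc is_shape_iff[of "S - {(r, c)}"]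
    by (auto simp: finite_shape intro: shape_down_closed dest: shape_ge_1)
qed

lemma finite_SYT:
  assumes "finite S"
  shows "finite (SYT S)"
proof (rule finite_subset)
  show "finite (PiE S (\<lambda>_. {1..card S}))"
    using assms by (intro finite_PiE) auto
  show "SYT S \<subseteq> PiE S (\<lambda>_. {1..card S})"
    by (auto simp: SYT_def bij_betw_def PiE_def)
qed

lemma SYT_row_less: "T \<in> SYT S \<Longrightarrow> (r, c) \<in> S \<Longrightarrow> (r, c') \<in> S \<Longrightarrow> c < c' \<Longrightarrow> T (r, c) < T (r, c')"
  unfolding SYT_def by blast

lemma SYT_column_less:
  "T \<in> SYT S \<Longrightarrow> (r, c) \<in> S \<Longrightarrow> (r', c) \<in> S \<Longrightarrow> r < r' \<Longrightarrow> T (r, c) < T (r', c)"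
  unfolding SYT_def by blast

lemma SYT_bij_betw: "T \<in> SYT S \<Longrightarrow> bij_betw T S {1..card S}"
  unfolding SYT_def by blast

lemma SYT_undefined: "T \<in> SYT S \<Longrightarrow> p \<notin> S \<Longrightarrow> T p = undefined"
  unfolding SYT_def extensional_def by blast

lemma SYT_remove_less_card:
  assumes "finite S" "p \<in> S" "T \<in> SYT (S - {p})" "q \<in> S - {p}"
  shows "T q < card S"
proof -
  have "T q \<le> card (S - {p})"
    using SYT_bij_betw[OF assms(3)] assms(4) by (auto simp: bij_betw_def)
  also have "\<dots> < card S"
    using assms(1,2) by (rule card_Diff1_less)
  finally show ?thesis .
qed

lemma SYT_extend:
  assumes S: "is_shape S" and p: "p \<in> corners S" and T: "T \<in> SYT (S - {p})"
  shows "T(p := card S) \<in> SYT S"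
proof -
  let ?T = "T(p := card S)"
  obtain r c where rc: "p = (r, c)"
    by (cases p)
  have pS: "p \<in> S" and fin: "finite S"
    using p S by (auto simp: corners_def finite_shape)
  have less: "T q < card S" if "q \<in> S" "q \<noteq> p" for q
    using SYT_remove_less_card[OF fin pS T] that by blast
  note maximal = corner_maximal[OF S p[unfolded rc]]
  have "bij_betw ?T (S - {p}) {1..card (S - {p})}"
    using SYT_bij_betw[OF T] by (rule bij_betw_cong[THEN iffD1, rotated]) auto
  then have "bij_betw ?T (S - {p} \<union> {p}) ({1..card (S - {p})} \<union> {?T p})"
    by (rule notIn_Un_bij_betw[rotated 2]) (use card_Suc_Diff1[OF fin pS] in auto)
  moreover have "{1..card (S - {p})} \<union> {?T p} = {1..card S}"
    using card_Suc_Diff1[OF fin pS] by auto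
  ultimately have "bij_betw ?T S {1..card S}"
    using pS by (simp add: insert_absorb)
  moreover have "?T \<in> extensional S"
    using SYT_undefined[OF T] pS by (auto simp: extensional_def)
  moreover have "?T (i, j) < ?T (i, j')" if "(i, j) \<in> S" "(i, j') \<in> S" "j < j'" for i j j'
    using that SYT_row_less[OF T, of i j j'] less[of "(i, j)"] maximal[of i j'] by (auto simp: rc)
  moreover have "?T (i, j) < ?T (i', j)" if "(i, j) \<in> S" "(i', j) \<in> S" "i < i'" for i i' j
    using that SYT_column_less[OF T, of i j i'] less[of "(i, j)"] maximal[of i' j]
    by (auto simp: rc)
  ultimately show ?thesis
    unfolding SYT_def by blast
qed

lemma SYT_restrict:
  assumes S: "is_shape S" and T: "T \<in> SYT S" and p: "p \<in> S" "T p = card S"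
  shows "p \<in> corners S" "T(p := undefined) \<in> SYT (S - {p})"
proof -
  obtain r c where rc: "p = (r, c)"
    by (cases p)
  have fin: "finite S"
    using S by (rule finite_shape)
  have bij: "bij_betw T S {1..card S}"
    using T by (rule SYT_bij_betw)
  then have le: "T q \<le> card S" if "q \<in> S" for q
    using that by (auto simp: bij_betw_def)
  show "p \<in> corners S"
    using SYT_row_less[OF T, of r c "Suc c"] SYT_column_less[OF T, of r c "Suc r"]
      le[of "(r, Suc c)"] le[of "(Suc r, c)"] p by (auto simp: rc corners_def)
  have "bij_betw T (S - {p}) ({1..card S} - {card S})"
    by (rule bij_betw_DiffI[OF bij]) (use p bij imageI[OF p(1), of T] in \<open>auto simp: bij_betw_def\<close>)
  also have "{1..card S} - {card S} = {1..card (S - {p})}"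
    using card_Suc_Diff1[OF fin p(1)] by (auto simp flip: less_Suc_eq_le)
  finally have "bij_betw (T(p := undefined)) (S - {p}) {1..card (S - {p})}"
    by (rule bij_betw_cong[THEN iffD1, rotated]) auto
  moreover have "T(p := undefined) \<in> extensional (S - {p})"
    using SYT_undefined[OF T] by (auto simp: extensional_def)
  ultimately show "T(p := undefined) \<in> SYT (S - {p})"
    unfolding SYT_def by (simp add: SYT_row_less[OF T] SYT_column_less[OF T])
qed

definition last_square :: "square set \<Rightarrow> (square \<Rightarrow> nat) \<Rightarrow> square" where
  "last_square S T = inv_into S T (card S)"

lemma last_square:
  assumes "finite S" "S \<noteq> {}" "T \<in> SYT S"
  shows "last_square S T \<in> S" "T (last_square S T) = card S"
proof -
  have "card S \<in> T ` S"
    using SYT_bij_betw[OF assms(3)] assms(1,2) by (auto simp: bij_betw_def Suc_le_eq card_gt_0_iff)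
  then show "last_square S T \<in> S" "T (last_square S T) = card S"
    unfolding last_square_def by (rule inv_into_into, rule f_inv_into_f)
qed

lemma last_square_eq: "T \<in> SYT S \<Longrightarrow> p \<in> S \<Longrightarrow> T p = card S \<Longrightarrow> last_square S T = p"
  unfolding last_square_def by (intro inv_into_f_eq bij_betw_imp_inj_on[OF SYT_bij_betw])

lemma sum_SYT_corners:
  assumes S: "is_shape S" "S \<noteq> {}"
  shows "(\<Sum>T\<in>SYT S. f T) = (\<Sum>p\<in>corners S. \<Sum>T\<in>SYT (S - {p}). f (T(p := card S)))"
proof -
  have fin: "finite S" and sub: "corners S \<subseteq> S"
    using S by (auto simp: finite_shape corners_def)
  note last = last_square[OF fin S(2)]
  have "(\<Sum>T\<in>SYT S. f T) = (\<Sum>(p, T)\<in>(SIGMA p:corners S. SYT (S - {p})). f (T(p := card S)))"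
  proof (rule sum.reindex_bij_witness[where i = "\<lambda>(p, T). T(p := card S)" and
        j = "\<lambda>T. (last_square S T, T(last_square S T := undefined))"])
    fix T
    assume T: "T \<in> SYT S"
    then show "(last_square S T, T(last_square S T := undefined)) \<in>
        (SIGMA p:corners S. SYT (S - {p}))"
      using SYT_restrict[OF S(1) T last[OF T]] by simp
  next
    fix x
    assume "x \<in> (SIGMA p:corners S. SYT (S - {p}))"
    then obtain p T where x: "x = (p, T)" and p: "p \<in> corners S" and T: "T \<in> SYT (S - {p})"
      by blast
    have ext: "T(p := card S) \<in> SYT S"
      by (rule SYT_extend[OF S(1) p T])
    then show "(case x of (p, T) \<Rightarrow> T(p := card S)) \<in> SYT S"
      by (simp add: x)
    have "last_square S (T(p := card S)) = p" "T p = undefined"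
      using last_square_eq[OF ext, of p] SYT_undefined[OF T] p sub by auto
    then show "(last_square S (case x of (p, T) \<Rightarrow> T(p := card S)),
        (case x of (p, T) \<Rightarrow> T(p := card S))
          (last_square S (case x of (p, T) \<Rightarrow> T(p := card S)) := undefined)) = x"
      by (simp add: x fun_upd_idem)
  qed (simp_all add: last fun_upd_idem)
  also have "\<dots> = (\<Sum>p\<in>corners S. \<Sum>T\<in>SYT (S - {p}). f (T(p := card S)))"
    using fin sub by (intro sum.Sigma[symmetric]) (auto intro: finite_SYT finite_subset)
  finally show ?thesis .
qed

lemma card_inversions_extend:
  assumes "finite S" "p \<in> S" "\<And>q. q \<in> S - {p} \<Longrightarrow> T q < k"
  shows "card (inversions S (T(p := k))) =
    card (inversions (S - {p}) T) + card {q \<in> S. precedes p q}"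
proof -
  have "(a, b) \<in> inversions S (T(p := k)) \<longleftrightarrow>
      (a, b) \<in> inversions (S - {p}) T \<union> Pair p ` {q \<in> S. precedes p q}" for a b
  proof (cases "a = p")
    case True
    then show ?thesis
      using assms(2) assms(3)[of b] by (auto simp: inversions_def precedes_def)
  next
    case False
    then show ?thesis
      using assms(3)[of a] by (auto simp: inversions_def)
  qed
  then have "inversions S (T(p := k)) = inversions (S - {p}) T \<union> Pair p ` {q \<in> S. precedes p q}"
    by auto
  moreover have "finite (inversions (S - {p}) T)"
    by (rule finite_subset[of _ "S \<times> S"]) (use assms(1) in \<open>auto simp: inversions_def\<close>)
  moreover have "inversions (S - {p}) T \<inter> Pair p ` {q \<in> S. precedes p q} = {}"
    by (auto simp: inversions_def)
  ultimately show ?thesis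
    using assms(1) by (simp add: card_Un_disjoint card_image inj_on_def)
qed

lemma sign_imbalance_corners:
  assumes S: "is_shape S" "S \<noteq> {}"
  shows "sign_imbalance S = signed_corner_sum sign_imbalance S"
proof -
  have "sgn_tableau S (T(p := card S)) =
      (- 1) ^ card {q \<in> S. precedes p q} * sgn_tableau (S - {p}) T"
    if p: "p \<in> corners S" and T: "T \<in> SYT (S - {p})" for p T
  proof -
    have "finite S" "p \<in> S"
      using S p by (auto simp: finite_shape corners_def)
    then have "card (inversions S (T(p := card S))) =
        card (inversions (S - {p}) T) + card {q \<in> S. precedes p q}"
      using SYT_remove_less_card[OF _ _ T] by (intro card_inversions_extend)
    then show ?thesis
      using is_shape_remove_corner[OF S(1) p] by (simp add: sgn_tableau_inversions S power_add)
  qed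
  then show ?thesis
    unfolding sign_imbalance_def signed_corner_sum_def sum_SYT_corners[OF S] sum_distrib_left
    by (intro sum.cong) auto
qed

section \<open>Shapes and boundary words\<close>

definition add_row :: "nat \<Rightarrow> square set \<Rightarrow> square set" where
  "add_row a A = Pair 1 ` {1..a} \<union> apfst Suc ` A"

lemma mem_apfst_Suc [simp]:
  "(Suc r, c) \<in> apfst Suc ` A \<longleftrightarrow> (r, c) \<in> A"
  "(0, c) \<notin> apfst Suc ` A"
  by (auto intro!: image_eqI[of _ _ "(r, c)"])

lemma inj_on_apfst_Suc [simp]: "inj_on (apfst Suc) A"
  by (auto simp: inj_on_def)

lemma mem_add_row [simp]:
  "(Suc r, c) \<in> add_row a A \<longleftrightarrow> r = 0 \<and> 1 \<le> c \<and> c \<le> a \<or> (r, c) \<in> A"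
  "(0, c) \<notin> add_row a A"
  by (auto simp: add_row_def)

primrec shape_of :: "bool list \<Rightarrow> square set" where
  "shape_of [] = {}"
| "shape_of (b # l) = (if b then add_row (horiz l) (shape_of l) else shape_of l)"

lemma shape_of_bounds: "(r, c) \<in> shape_of l \<Longrightarrow> 1 \<le> r \<and> 1 \<le> c \<and> c \<le> horiz l"
proof (induction l arbitrary: r)
  case (Cons b l)
  then show ?case
    by (cases r) (fastforce split: if_splits)+
qed simp

lemma is_shape_add_row:
  assumes A: "is_shape A" and bound: "\<And>r c. (r, c) \<in> A \<Longrightarrow> c \<le> a"
  shows "is_shape (add_row a A)"
  unfolding is_shape_iff
proof (intro conjI allI impI)
  show "finite (add_row a A)"
    using finite_shape[OF A] by (simp add: add_row_def)
  show "1 \<le> r" "1 \<le> c" if "(r, c) \<in> add_row a A" for r c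
    using that shape_ge_1[OF A] by (cases r; auto)+
  show "(r', c') \<in> add_row a A"
    if rc: "(r, c) \<in> add_row a A" and le: "1 \<le> r'" "r' \<le> r" "1 \<le> c'" "c' \<le> c" for r c r' c'
  proof -
    obtain i i' where i: "r = Suc i" "r' = Suc i'"
      using le by (cases r; cases r') auto
    show ?thesis
    proof (cases "i' = 0")
      case True
      then show ?thesis
        using rc le bound[of i c] by (auto simp: i)
    next
      case False
      then show ?thesis
        using rc le shape_down_closed[OF A, of i c i' c'] by (auto simp: i)
    qed
  qed
qed

lemma add_row_inject:
  assumes "add_row a A = add_row b B" "is_shape A" "is_shape B"
  shows "A = B"
proof -
  have "A = {(r, c). 1 \<le> r \<and> (Suc r, c) \<in> add_row a A}" if "is_shape A" for a A
    using shape_ge_1[OF that] by auto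
  from this[of A a] this[of B b] show ?thesis
    using assms by simp
qed

lemma is_shape_shape_of: "is_shape (shape_of l)"
  by (induction l) (auto simp: is_shape_iff[of "{}"] dest: shape_of_bounds intro: is_shape_add_row)

lemma finite_shape_of [simp]: "finite (shape_of l)"
  by (rule finite_shape[OF is_shape_shape_of])

lemma sum_add_row:
  assumes "is_shape A"
  shows "(\<Sum>x\<in>add_row a A. f x) = (\<Sum>c=1..a. f (1, c)) + (\<Sum>x\<in>A. f (apfst Suc x))"
proof -
  have "Pair 1 ` {1..a} \<inter> apfst Suc ` A = {}"
    using shape_ge_1[OF assms] by fastforce
  then show ?thesis
    using finite_shape[OF assms]
    by (simp add: add_row_def sum.union_disjoint sum.reindex inj_on_def[of "Pair _"] comp_def)
qed

lemma card_add_row: "is_shape A \<Longrightarrow> card (add_row a A) = a + card A"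
  using sum_add_row[of A "\<lambda>_. 1 :: nat" a] by simp

lemma card_shape_of: "card (shape_of l) = area l"
  by (induction l) (simp_all add: card_add_row is_shape_shape_of)

lemma shape_of_hd_neq:
  assumes "horiz l = Suc (horiz k)"
  shows "shape_of (True # l) \<noteq> shape_of (False # k)"
proof
  assume "shape_of (True # l) = shape_of (False # k)"
  then have "shape_of k = add_row (horiz l) (shape_of l)"
    by simp
  then have "(1, horiz l) \<in> shape_of k"
    using assms by simp
  then show False
    using shape_of_bounds[of 1 "horiz l" k] assms by simp
qed

lemma shape_of_inject:
  "shape_of l = shape_of l' \<Longrightarrow> length l = length l' \<Longrightarrow> horiz l = horiz l' \<Longrightarrow> l = l'"
proof (induction l arbitrary: l')
  case (Cons b l)
  then obtain b' k where l': "l' = b' # k" and len: "length l = length k"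
    by (metis length_Suc_conv)
  have "b = b'"
    using Cons.prems shape_of_hd_neq[of l k] shape_of_hd_neq[of k l] unfolding l'
    by (cases b; cases b') (simp_all del: shape_of.simps)
  moreover have "shape_of l = shape_of k"
  proof (cases b)
    case True
    then have "add_row (horiz l) (shape_of l) = add_row (horiz k) (shape_of k)"
      using Cons.prems(1) \<open>b = b'\<close> by (simp add: l')
    then show ?thesis
      using add_row_inject is_shape_shape_of by blast
  next
    case False
    then show ?thesis
      using Cons.prems(1) \<open>b = b'\<close> by (simp add: l')
  qed
  ultimately show ?case
    using Cons.IH[OF _ len] Cons.prems by (auto simp: l' split: if_splits)
qed simp

lemma shape_without_last_column:
  assumes S: "is_shape S" "S \<subseteq> {1..k} \<times> {1..Suc h}" and "(1, Suc h) \<notin> S"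
  shows "S \<subseteq> {1..k} \<times> {1..h}"
proof clarify
  fix r c
  assume rc: "(r, c) \<in> S"
  then have "c \<noteq> Suc h"
    using assms(3) shape_down_closed[OF S(1) rc, of 1 c] shape_ge_1[OF S(1) rc] by auto
  then show "r \<in> {1..k} \<and> c \<in> {1..h}"
    using rc S(2) by auto
qed

lemma shape_split_first_row:
  assumes S: "is_shape S" "S \<subseteq> {1..Suc k} \<times> {1..h}" and row: "h = 0 \<or> (1, h) \<in> S"
  obtains A where "is_shape A" "A \<subseteq> {1..k} \<times> {1..h}" "S = add_row h A"
proof -
  define A where "A = {(r, c). 1 \<le> r \<and> (Suc r, c) \<in> S}"
  have "finite (apfst Suc ` A)"
    by (rule finite_subset[OF _ finite_shape[OF S(1)]]) (auto simp: A_def)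
  then have "finite A"
    by (rule finite_imageD) simp
  then have "is_shape A"
    using shape_ge_1[OF S(1)] unfolding is_shape_iff
    by (auto simp: A_def intro: shape_down_closed[OF S(1)])
  moreover have "A \<subseteq> {1..k} \<times> {1..h}"
    using S(2) by (auto simp: A_def)
  moreover have "(r, c) \<in> S \<longleftrightarrow> (r, c) \<in> add_row h A" for r c
    using row S(2) shape_down_closed[OF S(1), of 1 h 1 c] shape_ge_1[OF S(1), of r c]
    by (cases r) (auto simp: A_def)
  then have "S = add_row h A"
    by auto
  ultimately show ?thesis
    using that by blast
qed

lemma ex_shape_of:
  "is_shape S \<Longrightarrow> S \<subseteq> {1..k} \<times> {1..h} \<Longrightarrow> \<exists>l. length l = k + h \<and> horiz l = h \<and> shape_of l = S"
proof (induction "k + h" arbitrary: k h S)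
  case 0
  then show ?case by auto
next
  case (Suc n)
  consider (column) h' where "h = Suc h'" "(1, h) \<notin> S"
    | (row) k' where "k = Suc k'" "h = 0 \<or> (1, h) \<in> S"
    using Suc.hyps(2) Suc.prems(2) by (cases h; cases k) auto
  then show ?case
  proof cases
    case column
    then have "S \<subseteq> {1..k} \<times> {1..h'}"
      using shape_without_last_column[OF Suc.prems(1)] Suc.prems(2) by blast
    then obtain l where "length l = k + h'" "horiz l = h'" "shape_of l = S"
      using Suc.hyps(1)[of k h' S] Suc.hyps(2) column(1) Suc.prems(1) by auto
    then show ?thesis
      using column(1) by (intro exI[of _ "False # l"]) simp
  next
    case row
    then obtain A where A: "is_shape A" "A \<subseteq> {1..k'} \<times> {1..h}" "S = add_row h A"
      using shape_split_first_row[OF Suc.prems(1)] Suc.prems(2) by blast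
    then obtain l where "length l = k' + h" "horiz l = h" "shape_of l = A"
      using Suc.hyps(1)[of k' h A] Suc.hyps(2) row(1) by auto
    then show ?thesis
      using A(3) row(1) by (intro exI[of _ "True # l"]) simp
  qed
qed

lemma shape_subset_box:
  assumes S: "is_shape S"
  shows "S \<subseteq> {1..card S} \<times> {1..card S}"
proof clarify
  fix r c
  assume rc: "(r, c) \<in> S"
  then have "(\<lambda>i. (i, c)) ` {1..r} \<subseteq> S" "Pair r ` {1..c} \<subseteq> S"
    using shape_ge_1[OF S rc] by (auto intro: shape_down_closed[OF S rc])
  then have "card ((\<lambda>i. (i, c)) ` {1..r}) \<le> card S" "card (Pair r ` {1..c}) \<le> card S"
    using finite_shape[OF S] by (auto intro: card_mono)
  then show "r \<in> {1..card S} \<and> c \<in> {1..card S}"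
    using shape_ge_1[OF S rc] by (simp add: card_image inj_on_def)
qed

lemma inj_on_shape_of: "inj_on shape_of (box_words N)"
  by (auto simp: inj_on_def box_words_def intro: shape_of_inject)

lemma ex_box_word:
  assumes "is_shape S" "card S \<le> N"
  obtains l where "l \<in> box_words N" "shape_of l = S"
proof -
  have "S \<subseteq> {1..N} \<times> {1..N}"
    using shape_subset_box[OF assms(1)] assms(2) by fastforce
  then obtain l where "length l = N + N" "horiz l = N" "shape_of l = S"
    using ex_shape_of[OF assms(1)] by blast
  then show ?thesis
    using that[of l] by (simp add: box_words_def)
qed

lemma corners_add_row:
  assumes A: "is_shape A" and bound: "\<And>r c. (r, c) \<in> A \<Longrightarrow> c \<le> a"
  shows "corners (add_row a A) =
    (if 1 \<le> a \<and> (1, a) \<notin> A then {(1, a)} else {}) \<union> apfst Suc ` corners A"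
proof -
  have "(r, c) \<in> corners (add_row a A) \<longleftrightarrow>
      (r, c) \<in> (if 1 \<le> a \<and> (1, a) \<notin> A then {(1, a)} else {}) \<union> apfst Suc ` corners A" for r c
  proof (cases r)
    case 0
    then show ?thesis
      by (simp add: corners_def)
  next
    case (Suc i)
    then show ?thesis
      using shape_ge_1[OF A, of i c] shape_ge_1[OF A, of i "Suc c"] bound[of i c]
        bound[of i "Suc c"] shape_down_closed[OF A, of 1 a 1 c]
      by (cases "i = 0") (auto simp: corners_def)
  qed
  then show ?thesis
    by auto
qed

lemma signed_corner_sum_add_row:
  assumes A: "is_shape A" and bound: "\<And>r c. (r, c) \<in> A \<Longrightarrow> c \<le> a"
  shows "signed_corner_sum f (add_row a A) =
    (if 1 \<le> a \<and> (1, a) \<notin> A then (- 1) ^ card A * f (add_row (a - 1) A) else 0) +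
    signed_corner_sum (\<lambda>B. f (add_row a B)) A"
proof -
  define summand where
    "summand p = (- 1) ^ card {q \<in> add_row a A. precedes p q} * f (add_row a A - {p})" for p
  have no_row_0: "(0, c) \<notin> A" for c
    using shape_ge_1[OF A, of 0 c] by auto
  have fin: "finite (corners A)"
    by (rule finite_subset[OF _ finite_shape[OF A]]) (auto simp: corners_def)
  have "{q \<in> add_row a A. precedes (1, a) q} = apfst Suc ` A"
    by (auto simp: add_row_def precedes_def dest: shape_ge_1[OF A])
  moreover have "add_row a A - {(1, a)} = add_row (a - 1) A" if "1 \<le> a"
    using that no_row_0 by (auto simp: add_row_def image_iff[of _ "Pair _"])
  ultimately have first: "summand (1, a) = (- 1) ^ card A * f (add_row (a - 1) A)" if "1 \<le> a"
    using that by (simp add: summand_def card_image)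
  have rest: "summand (apfst Suc p) =
      (- 1) ^ card {q \<in> A. precedes p q} * f (add_row a (A - {p}))" if "p \<in> A" for p
  proof -
    have "{q \<in> add_row a A. precedes (apfst Suc p) q} = apfst Suc ` {q \<in> A. precedes p q}"
      using that no_row_0 by (cases p) (auto simp: add_row_def precedes_def)
    moreover have "add_row a A - {apfst Suc p} = add_row a (A - {p})"
      using that no_row_0 by (cases p) (auto simp: add_row_def)
    ultimately show ?thesis
      by (simp add: summand_def card_image)
  qed
  have "corners (add_row a A) =
      (if 1 \<le> a \<and> (1, a) \<notin> A then {(1, a)} else {}) \<union> apfst Suc ` corners A"
    using A bound by (rule corners_add_row)
  moreover have "(1, a) \<notin> apfst Suc ` corners A"
    using no_row_0 by (auto simp: corners_def)
  ultimately have "(\<Sum>p\<in>corners (add_row a A). summand p) =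
      (if 1 \<le> a \<and> (1, a) \<notin> A then summand (1, a) else 0) + (\<Sum>p\<in>apfst Suc ` corners A. summand p)"
    using fin by auto
  also have "(\<Sum>p\<in>apfst Suc ` corners A. summand p) = (\<Sum>p\<in>corners A. summand (apfst Suc p))"
    by (simp add: sum.reindex comp_def)
  also have "\<dots> = signed_corner_sum (\<lambda>B. f (add_row a B)) A"
    unfolding signed_corner_sum_def by (intro sum.cong refl rest) (auto simp: corners_def)
  finally show ?thesis
    using first by (simp add: signed_corner_sum_def summand_def)
qed

lemma corner_sum_shape_of:
  "corner_sum (\<lambda>t. f (shape_of t)) l = signed_corner_sum f (shape_of l)"
proof (induction l arbitrary: f)
  case Nil
  then show ?case
    by (simp add: signed_corner_sum_def corners_def)
next
  case (Cons b l)
  show ?case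
  proof (cases b)
    case False
    then show ?thesis
      using Cons[of f] by (simp add: corner_sum_on_Cons)
  next
    case True
    have "corner_sum (\<lambda>t. f (shape_of (True # t))) l =
        corner_sum (\<lambda>t. f (add_row (horiz l) (shape_of t))) l"
      by (intro exchange_sum_cong) (simp add: corner_removal_measures)
    also have "\<dots> = signed_corner_sum (\<lambda>B. f (add_row (horiz l) B)) (shape_of l)"
      by (rule Cons)
    finally have "corner_sum (\<lambda>t. f (shape_of t)) (True # l) =
        (if l \<noteq> [] \<and> \<not> hd l then area_sign (tl l) * f (shape_of (False # True # tl l)) else 0) +
        signed_corner_sum (\<lambda>B. f (add_row (horiz l) B)) (shape_of l)"
      by (simp add: corner_sum_on_Cons)
    moreover have "1 \<le> horiz l \<and> (1, horiz l) \<notin> shape_of l \<longleftrightarrow> l \<noteq> [] \<and> \<not> hd l"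
    proof (cases l)
      case (Cons b' s)
      then show ?thesis
        using shape_of_bounds[of 1 "Suc (horiz s)" s] by (cases b') auto
    qed simp
    ultimately show ?thesis
      using True signed_corner_sum_add_row[OF is_shape_shape_of, of l "horiz l" f]
        shape_of_bounds[of _ _ l]
      by (cases l) (auto simp: card_shape_of area_sign_def)
  qed
qed

lemma sign_imbalance_shape_of:
  "l \<in> box_words N \<Longrightarrow> real_of_int (sign_imbalance (shape_of l)) = imbalance N (area l) l"
proof (induction "area l" arbitrary: l)
  case 0
  then have "shape_of l = {}"
    using card_shape_of[of l] by simp
  then show ?case
    using 0 by (simp add: sign_imbalance_empty flip: box_words_area_0)
next
  case (Suc n)
  then have "shape_of l \<noteq> {}"
    using card_shape_of[of l] by auto
  then have "real_of_int (sign_imbalance (shape_of l)) =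
      real_of_int (signed_corner_sum sign_imbalance (shape_of l))"
    by (simp add: sign_imbalance_corners is_shape_shape_of)
  also have "\<dots> = signed_corner_sum (\<lambda>S. real_of_int (sign_imbalance S)) (shape_of l)"
    by (simp add: signed_corner_sum_def)
  also have "\<dots> = corner_sum (\<lambda>t. real_of_int (sign_imbalance (shape_of t))) l"
    by (rule corner_sum_shape_of[symmetric])
  also have "\<dots> = corner_sum (imbalance N n) l"
    using Suc by (intro exchange_sum_cong)
      (metis corner_removal_box_words corner_removal_measures(3) nat.inject)
  finally show ?case
    using Suc(2) by (simp flip: Suc(2))
qed

section \<open>Fourling bodies and strips\<close>

text \<open>
  The union of the fourlings with odd top-left coordinates that are contained in the shape \<open>S\<close>:
  the square \<open>(2 i, 2 j)\<close> is the bottom-right one of its fourling.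
\<close>

definition fourlings :: "square set \<Rightarrow> square set" where
  "fourlings S = {(r, c). 1 \<le> r \<and> 1 \<le> c \<and> (2 * ((r + 1) div 2), 2 * ((c + 1) div 2)) \<in> S}"

lemma mem_fourlings:
  "(r, c) \<in> fourlings S \<longleftrightarrow> 1 \<le> r \<and> 1 \<le> c \<and> (2 * ((r + 1) div 2), 2 * ((c + 1) div 2)) \<in> S"
  by (simp add: fourlings_def)

lemma fourlings_subset:
  assumes "is_shape S"
  shows "fourlings S \<subseteq> S"
proof clarify
  fix r c
  assume "(r, c) \<in> fourlings S"
  moreover have "r \<le> 2 * ((r + 1) div 2)" "c \<le> 2 * ((c + 1) div 2)"
    by presburger+
  ultimately show "(r, c) \<in> S"
    using shape_down_closed[OF assms] by (auto simp: mem_fourlings)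
qed

lemma fourling_shape_fourlings:
  assumes "is_shape S"
  shows "fourling_shape (fourlings S)"
  unfolding fourling_shape_iff is_shape_iff
proof (intro conjI allI impI)
  show "finite (fourlings S)"
    using fourlings_subset[OF assms] finite_shape[OF assms] by (rule finite_subset)
  show "1 \<le> r" "1 \<le> c" if "(r, c) \<in> fourlings S" for r c
    using that by (simp_all add: mem_fourlings)
  show "(2 * ((r + 1) div 2), 2 * ((c + 1) div 2)) \<in> fourlings S" if "(r, c) \<in> fourlings S" for r c
    using that by (auto simp: mem_fourlings)
  show "(r', c') \<in> fourlings S"
    if "(r, c) \<in> fourlings S" "1 \<le> r'" "r' \<le> r" "1 \<le> c'" "c' \<le> c" for r c r' c'
  proof -
    have "1 \<le> 2 * ((r' + 1) div 2)" "2 * ((r' + 1) div 2) \<le> 2 * ((r + 1) div 2)"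
      "1 \<le> 2 * ((c' + 1) div 2)" "2 * ((c' + 1) div 2) \<le> 2 * ((c + 1) div 2)"
      using that by presburger+
    then show ?thesis
      using that shape_down_closed[OF assms] unfolding mem_fourlings by blast
  qed
qed

lemma fb_eq_fourlings:
  assumes "is_shape S"
  shows "fb S = fourlings S"
proof
  show "fourlings S \<subseteq> fb S"
    using fb_greatest(3)[OF assms fourling_shape_fourlings[OF assms] fourlings_subset[OF assms]] .
  show "fb S \<subseteq> fourlings S"
  proof clarify
    fix r c
    assume rc: "(r, c) \<in> fb S"
    have "is_shape (fb S)" "(2 * ((r + 1) div 2), 2 * ((c + 1) div 2)) \<in> fb S"
      using fb_greatest(1)[OF assms] rc unfolding fourling_shape_iff by blast+
    then show "(r, c) \<in> fourlings S"
      using fb_greatest(2)[OF assms] shape_ge_1[OF _ rc] by (auto simp: mem_fourlings)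
  qed
qed

lemma fourlings_add_row_cong: "fourlings (add_row a A) = fourlings (add_row b A)"
proof -
  have "(2 * ((r + 1) div 2), y) \<in> add_row a A \<longleftrightarrow> (2 * ((r + 1) div 2), y) \<in> add_row b A"
    if "1 \<le> r" for r y
  proof -
    have "2 * ((r + 1) div 2) = Suc (Suc (2 * ((r - 1) div 2)))"
      using that by presburger
    then show ?thesis
      by (simp only: mem_add_row nat.distinct simp_thms)
  qed
  then show ?thesis
    by (auto simp: fourlings_def)
qed

lemma fourlings_add_two_rows:
  assumes "is_shape A"
  shows "fourlings (add_row a (add_row b A)) =
    add_row (2 * (b div 2)) (add_row (2 * (b div 2)) (fourlings A))"
proof -
  have "(r, c) \<in> fourlings (add_row a (add_row b A)) \<longleftrightarrow>
      (r, c) \<in> add_row (2 * (b div 2)) (add_row (2 * (b div 2)) (fourlings A))" for r c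
  proof -
    have no_row_0: "(0, y) \<notin> A" "(0, y) \<notin> fourlings A" for y
      using shape_ge_1[OF assms, of 0 y] by (auto simp: mem_fourlings)
    consider "r = 0" | "r = 1 \<or> r = 2" | k where "r = Suc (Suc (Suc k))"
      by (metis One_nat_def Suc_1 not0_implies_Suc)
    then show ?thesis
    proof cases
      case 2
      have second_row: "(2, y) \<in> add_row a (add_row b A) \<longleftrightarrow> 1 \<le> y \<and> y \<le> b" for y
        by (simp add: numeral_2_eq_2 no_row_0)
      have "2 * ((r + 1) div 2) = 2"
        using 2 by auto
      then have "(r, c) \<in> fourlings (add_row a (add_row b A)) \<longleftrightarrow>
          1 \<le> r \<and> 1 \<le> c \<and> 1 \<le> 2 * ((c + 1) div 2) \<and> 2 * ((c + 1) div 2) \<le> b"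
        unfolding mem_fourlings second_row[symmetric] by simp
      also have "\<dots> \<longleftrightarrow> 1 \<le> c \<and> c \<le> 2 * (b div 2)"
        using 2 by presburger
      finally show ?thesis
        using 2 no_row_0(2) by (auto simp: numeral_2_eq_2)
    next
      case 3
      have row: "2 * ((r + 1) div 2) = Suc (Suc (2 * ((Suc k + 1) div 2)))"
        by (simp add: 3)
      have "(r, c) \<in> fourlings (add_row a (add_row b A)) \<longleftrightarrow> (Suc k, c) \<in> fourlings A"
        unfolding mem_fourlings row mem_add_row by (auto simp: 3)
      also have "\<dots> \<longleftrightarrow> (r, c) \<in> add_row (2 * (b div 2)) (add_row (2 * (b div 2)) (fourlings A))"
        by (simp add: 3)
      finally show ?thesis .
    qed (simp add: mem_fourlings)
  qed
  then show ?thesis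
    by auto
qed

lemma fourlings_shape_of:
  assumes "even (length l)" "odd (horiz l) = W"
  shows "fourlings (if W then add_row (horiz l) (shape_of l) else shape_of l) =
    shape_of (body_word W l)"
  using assms
proof (induction W l rule: body_word.induct)
  case (1 W p q l)
  have "horiz l = horiz (body_word V l) + of_bool V" if "odd (horiz l) = V" for V
    using horiz_body_word[of l V] 1 that by simp
  then show ?case
    using 1 is_shape_shape_of[of "True # l"] fourlings_add_row_cong[of "Suc (horiz l)" _ "horiz l"]
      fourlings_add_row_cong[of "Suc (Suc (horiz l))" _ "horiz l"]
    by (cases p; cases q; cases W) (auto simp: fourlings_add_two_rows is_shape_shape_of)
qed (auto simp: fourlings_def)

lemma fb_shape_of:
  assumes "even N" "l \<in> box_words N"
  shows "fb (shape_of l) = shape_of (body_word False l)"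
  using assms fourlings_shape_of[of l False]
  by (simp add: fb_eq_fourlings is_shape_shape_of box_words_def)

lemma body_word_in_box_words:
  assumes "even N" "l \<in> box_words N"
  shows "body_word False l \<in> box_words N"
  using assms horiz_body_word[of l False] by (simp add: box_words_def length_body_word)

lemma card_strip_filter:
  assumes "is_shape S"
  shows "card {x \<in> S. P x} = card {x \<in> fb S. P x} + card {x \<in> strip S. P x}"
proof -
  have "{x \<in> S. P x} = {x \<in> fb S. P x} \<union> {x \<in> strip S. P x}"
    using fb_greatest(2)[OF assms] by (auto simp: strip_def)
  moreover have "finite (fb S)" "finite (strip S)"
    using finite_shape[OF assms] fb_greatest(2)[OF assms] by (auto simp: strip_def finite_subset)
  moreover have "fb S \<inter> strip S = {}"
    by (auto simp: strip_def)
  ultimately show ?thesis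
    by (subst card_Un_disjoint[symmetric]) auto
qed

lemma card_strip: "is_shape S \<Longrightarrow> card S = card (fb S) + card (strip S)"
  using card_strip_filter[of S "\<lambda>_. True"] by simp

lemma card_disjoint_dominoes_le:
  assumes "finite A" and F: "\<forall>d\<in>F. vertical_domino d \<and> d \<subseteq> A" "pairwise disjnt F"
  shows "card F \<le> card {x \<in> A. even (fst x)}"
proof -
  have "\<exists>x. x \<in> d \<and> x \<in> A \<and> even (fst x)" if "d \<in> F" for d
  proof -
    from F(1) that have "vertical_domino d" "d \<subseteq> A"
      by auto
    then obtain r c where "d = {(r, c), (Suc r, c)}" "d \<subseteq> A"
      unfolding vertical_domino_def by blast
    then show ?thesis
      by (intro exI[of _ "if even r then (r, c) else (Suc r, c)"]) auto
  qed
  then obtain e where e: "\<And>d. d \<in> F \<Longrightarrow> e d \<in> d \<and> e d \<in> A \<and> even (fst (e d))"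
    by metis
  have "inj_on e F"
  proof (rule inj_onI)
    fix d d'
    assume "d \<in> F" "d' \<in> F" "e d = e d'"
    then have "\<not> disjnt d d'"
      using e by (metis disjnt_iff)
    then show "d = d'"
      using F(2) \<open>d \<in> F\<close> \<open>d' \<in> F\<close> unfolding pairwise_def by blast
  qed
  then show ?thesis
    by (rule card_inj_on_le) (use assms(1) e in auto)
qed

lemma Max_disjoint_dominoes:
  assumes fin: "finite A" and up: "\<And>r c. (r, c) \<in> A \<Longrightarrow> even r \<Longrightarrow> r \<noteq> 0 \<and> (r - 1, c) \<in> A"
  shows "Max {card F | F. (\<forall>d\<in>F. vertical_domino d \<and> d \<subseteq> A) \<and> pairwise disjnt F} =
    card {x \<in> A. even (fst x)}"
    (is "Max ?C = card ?E")
proof (rule Max_eqI)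
  have bound: "k \<le> card ?E" if "k \<in> ?C" for k
    using that card_disjoint_dominoes_le[OF fin] by blast
  then show "k \<le> card ?E" if "k \<in> ?C" for k
    using that .
  show "finite ?C"
    by (rule finite_subset[of _ "{..card ?E}"]) (use bound in auto)
  define domino where "domino x = {(fst x - 1, snd x), x}" for x :: square
  have lower_square: "x = (2 * ((fst z + 1) div 2), snd z)" if "x \<in> ?E" "z \<in> domino x" for x z
    using that up[of "fst x" "snd x"] by (auto simp: domino_def prod_eq_iff elim!: evenE)
  have unique: "x = y" if "x \<in> ?E" "y \<in> ?E" "z \<in> domino x" "z \<in> domino y" for x y z
    using lower_square[OF that(1,3)] lower_square[OF that(2,4)] by (rule trans[OF _ sym])
  have "inj_on domino ?E"
  proof (rule inj_onI)
    fix x y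
    assume "x \<in> ?E" "y \<in> ?E" "domino x = domino y"
    moreover have "x \<in> domino x"
      by (simp add: domino_def)
    ultimately show "x = y"
      using unique[of x y x] by simp
  qed
  then have "card ?E = card (domino ` ?E)"
    by (simp add: card_image)
  moreover have "vertical_domino (domino x) \<and> domino x \<subseteq> A" if "x \<in> ?E" for x
    using that up[of "fst x" "snd x"]
    by (cases x) (auto simp: domino_def vertical_domino_def gr0_conv_Suc, blast)
  moreover have "pairwise disjnt (domino ` ?E)"
  proof (rule pairwise_imageI)
    fix x y
    assume "x \<in> ?E" "y \<in> ?E" "x \<noteq> y"
    then show "disjnt (domino x) (domino y)"
      using unique[of x y] unfolding disjnt_iff by blast
  qed
  ultimately show "card ?E \<in> ?C"
    by blast
qed

lemma vs_eq:
  assumes "is_shape S"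
  shows "vs S = card {x \<in> strip S. even (fst x)}"
  unfolding vs_def
proof (rule Max_disjoint_dominoes)
  show "finite (strip S)"
    using finite_shape[OF assms] by (simp add: strip_def)
  fix r c
  assume rc: "(r, c) \<in> strip S" "even r"
  then have "(r, c) \<in> S" "(r, c) \<notin> fourlings S"
    by (auto simp: strip_def fb_eq_fourlings[OF assms])
  moreover from this have "2 \<le> r" "1 \<le> c"
    using rc(2) shape_ge_1[OF assms, of r c] by auto
  moreover have "(r - 1 + 1) div 2 = (r + 1) div 2"
    using rc(2) \<open>2 \<le> r\<close> by auto
  ultimately show "r \<noteq> 0 \<and> (r - 1, c) \<in> strip S"
    using shape_down_closed[OF assms, of r c "r - 1" c]
    by (auto simp: strip_def fb_eq_fourlings[OF assms] mem_fourlings)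
qed

lemma is_shape_conjugate:
  assumes "is_shape S"
  shows "is_shape (conjugate S)"
proof -
  have "conjugate S = prod.swap ` S"
    by (auto simp: conjugate_def)
  then have "finite (conjugate S)"
    using finite_shape[OF assms] by simp
  then show ?thesis
    using shape_ge_1[OF assms] shape_down_closed[OF assms]
    unfolding is_shape_iff[of "conjugate S"] unfolding conjugate_def by blast
qed

lemma hs_eq:
  assumes "is_shape S"
  shows "hs S = card {x \<in> strip S. even (snd x)}"
proof -
  have "fourlings (conjugate S) = conjugate (fourlings S)"
    by (auto simp: fourlings_def conjugate_def)
  then have "strip (conjugate S) = conjugate (strip S)"
    unfolding strip_def fb_eq_fourlings[OF assms] fb_eq_fourlings[OF is_shape_conjugate[OF assms]]
    by (auto simp: conjugate_def)
  then have "{x \<in> strip (conjugate S). even (fst x)} = prod.swap ` {x \<in> strip S. even (snd x)}"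
    by (auto simp: conjugate_def)
  then show ?thesis
    by (simp add: hs_def vs_eq is_shape_conjugate assms card_image)
qed

lemma hs_add_vs_eq:
  assumes "is_shape S"
  shows "hs S + vs S = card {x \<in> strip S. odd (fst x + snd x)}"
proof -
  have "odd r \<or> odd c" if "(r, c) \<in> strip S" for r c
    using that shape_ge_1[OF assms, of r c]
    by (auto simp: strip_def fb_eq_fourlings[OF assms] mem_fourlings elim!: evenE)
  then have "{x \<in> strip S. odd (fst x + snd x)} =
        {x \<in> strip S. even (snd x)} \<union> {x \<in> strip S. even (fst x)}"
      "{x \<in> strip S. even (snd x)} \<inter> {x \<in> strip S. even (fst x)} = {}"
    by fastforce+
  moreover have "finite (strip S)"
    using finite_shape[OF assms] by (simp add: strip_def)
  ultimately show ?thesis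
    by (simp add: hs_eq vs_eq assms card_Un_disjoint)
qed

lemma card_even_columns_shape_of: "card {x \<in> shape_of l. even (snd x)} = half_area l"
proof -
  have row: "(\<Sum>c=Suc 0..a. of_bool (even c)) = a div 2" for a
    by (induction a) auto
  have "(\<Sum>x\<in>shape_of l. of_bool (even (snd x))) = half_area l"
    by (induction l) (simp_all add: sum_add_row is_shape_shape_of row del: sum_of_bool_eq)
  then show ?thesis
    by (simp add: Collect_conj_eq)
qed

lemma hs_shape_of:
  assumes "even N" "l \<in> box_words N"
  shows "half_area l = half_area (body_word False l) + hs (shape_of l)"
  using card_strip_filter[OF is_shape_shape_of, of l "\<lambda>x. even (snd x)"]
  by (simp add: fb_shape_of[OF assms] card_even_columns_shape_of hs_eq is_shape_shape_of)

definition colour_excess :: "square set \<Rightarrow> int" where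
  "colour_excess S = (\<Sum>x\<in>S. (- 1) ^ (fst x + snd x))"

lemma colour_excess_add_row:
  assumes "is_shape A"
  shows "colour_excess (add_row a A) = of_bool (odd a) - colour_excess A"
proof -
  have "(\<Sum>c=1..a. (- 1) ^ (1 + c)) = (of_bool (odd a) :: int)"
    by (induction a) auto
  then show ?thesis
    by (simp add: colour_excess_def sum_add_row[OF assms] sum_negf)
qed

lemma balance_eq_colour_excess:
  "even (length l) \<Longrightarrow> balance l =
     (if even (horiz l) then 2 * colour_excess (shape_of l)
      else 1 - 2 * colour_excess (shape_of l))"
proof (induction l rule: paired.induct)
  case 1
  then show ?case
    by (simp add: colour_excess_def)
next
  case (3 p q l)
  then show ?case
    by (cases p; cases q)
      (auto simp: colour_excess_add_row is_shape_add_row is_shape_shape_of shape_of_bounds)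
qed simp

lemma balance_paired: "paired l \<Longrightarrow> balance l = 0"
proof (induction l rule: paired.induct)
  case (3 p q l)
  then show ?case
    using paired_even[of l] by simp
qed auto

lemma colour_excess_fb:
  assumes "is_shape S"
  shows "colour_excess (fb S) = 0"
proof -
  obtain l where l: "l \<in> box_words (2 * card S)" "shape_of l = S"
    using ex_box_word[OF assms, of "2 * card S"] by auto
  have "colour_excess (shape_of (body_word False l)) = 0"
    using balance_eq_colour_excess[of "body_word False l"] balance_paired[OF paired_body_word]
      paired_even[OF paired_body_word] by simp
  then show ?thesis
    using fb_shape_of[of "2 * card S" l] l by simp
qed

lemma card_strip_colours:
  assumes "is_shape S"
  shows "int (card (strip S)) = 2 * int (hs S + vs S) + colour_excess S"
proof -
  have fin: "finite (strip S)"
    using finite_shape[OF assms] by (simp add: strip_def)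
  have "colour_excess S = colour_excess (strip S)"
    using colour_excess_fb[OF assms] fb_greatest(2)[OF assms] finite_shape[OF assms]
    by (simp add: colour_excess_def strip_def sum_diff)
  also have "\<dots> = (\<Sum>x\<in>strip S. 1 - 2 * of_bool (odd (fst x + snd x)))"
    unfolding colour_excess_def by (intro sum.cong) (auto simp: minus_one_power_iff)
  also have "\<dots> = int (card (strip S)) - 2 * int (hs S + vs S)"
    using fin unfolding hs_add_vs_eq[OF assms]
    by (simp add: sum_subtractf Collect_conj_eq flip: sum_distrib_left)
  finally show ?thesis
    by simp
qed

lemma hs_add_vs_eq_half_card_strip:
  assumes S: "is_shape S" and "sign_imbalance S \<noteq> 0"
  shows "hs S + vs S = card (strip S) div 2"
proof -
  let ?N = "2 * card S"
  obtain l where l: "l \<in> box_words ?N" "shape_of l = S"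
    using ex_box_word[OF S, of ?N] by auto
  then have "balance l = 2 * of_bool (odd (area l))"
    using balance_imbalance[of ?N "area l" l] sign_imbalance_shape_of[OF l(1)] assms(2) by auto
  moreover have "balance l = 2 * colour_excess S"
    using balance_eq_colour_excess[of l] l by (auto simp: box_words_def)
  ultimately have "int (card (strip S)) = 2 * int (hs S + vs S) + of_bool (odd (area l))"
    using card_strip_colours[OF S] by simp
  then have "card (strip S) = 2 * (hs S + vs S) + of_bool (odd (area l))"
    by (cases "odd (area l)") auto
  then show ?thesis
    by (cases "odd (area l)") simp_all
qed

lemma fb_shape_of_eq_iff:
  assumes "even N" "l \<in> box_words N" "d \<in> box_words N"
  shows "fb (shape_of l) = shape_of d \<longleftrightarrow> body_word False l = d"
  using inj_on_eq_iff[OF inj_on_shape_of body_word_in_box_words[OF assms(1,2)] assms(3)]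
  unfolding fb_shape_of[OF assms(1,2)] .

lemma shape_of_image_fixed_body:
  assumes N: "even N" "card D + s \<le> N" and d: "d \<in> box_words N" "shape_of d = D"
  shows "shape_of ` {l \<in> box_words N. area l = card D + s \<and> body_word False l = d \<and>
      half_area l = half_area d + h} =
    {S. is_shape S \<and> fb S = D \<and> card (strip S) = s \<and> hs S = h}"
    (is "shape_of ` ?W = ?S")
proof (intro equalityI subsetI)
  fix S
  assume S: "S \<in> ?S"
  then have card: "card S = card D + s"
    using card_strip[of S] by simp
  then obtain l where l: "l \<in> box_words N" "shape_of l = S"
    using ex_box_word[of S N] S N(2) by auto
  then have "l \<in> ?W"
    using S card fb_shape_of_eq_iff[OF N(1) l(1) d(1)] hs_shape_of[OF N(1) l(1)]
      card_shape_of[of l] by (simp add: d(2))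
  then show "S \<in> shape_of ` ?W"
    using l(2) by blast
next
  fix S
  assume "S \<in> shape_of ` ?W"
  then obtain l where l: "l \<in> ?W" "S = shape_of l"
    by blast
  then show "S \<in> ?S"
    using fb_shape_of_eq_iff[OF N(1) _ d(1), of l] hs_shape_of[OF N(1), of l] card_strip[of S]
      card_shape_of[of l] by (simp add: d(2) is_shape_shape_of)
qed

lemma fb_fourling_shape:
  assumes "fourling_shape D"
  shows "fb D = D"
proof -
  have "is_shape D"
    using assms by (simp add: fourling_shape_def)
  then show ?thesis
    using fb_greatest(2)[of D] fb_greatest(3)[of D, OF _ assms] by blast
qed

lemma sum_sign_imbalance_fixed_hs:
  assumes D: "fourling_shape D" "D \<noteq> {}"
  shows "(\<Sum>S | is_shape S \<and> fb S = D \<and> card (strip S) = s \<and> hs S = h. sign_imbalance S) = 0"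
proof -
  have shape_D: "is_shape D"
    using D(1) by (simp add: fourling_shape_def)
  define n where "n = card D + s"
  define N where "N = 2 * (n + 1)"
  have N: "even N" "n < N" "n \<le> N" "card D \<le> N"
    by (simp_all add: N_def n_def)
  obtain d where d: "d \<in> box_words N" "shape_of d = D"
    using ex_box_word[OF shape_D N(4)] .
  define W where "W = {l \<in> box_words N.
    area l = n \<and> body_word False l = d \<and> half_area l = half_area d + h}"
  have "paired d"
    using fb_shape_of_eq_iff[OF N(1) d(1,1)] fb_fourling_shape[OF D(1)] paired_body_word[of False d]
    by (simp add: d(2))
  moreover have "area d > 0"
    using card_shape_of[of d] D(2) finite_shape[OF shape_D] by (metis card_gt_0_iff d(2))
  ultimately have "(\<Sum>l | l \<in> words (2 * N) \<and> body_word False l = d \<and>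
      half_area l = half_area d + h. imbalance N n l) = 0"
    using d(1) N by (intro sum_imbalance_fixed_body) (simp_all add: box_words_def)
  also have "(\<Sum>l | l \<in> words (2 * N) \<and> body_word False l = d \<and>
      half_area l = half_area d + h. imbalance N n l) = (\<Sum>l\<in>W. imbalance N n l)"
  proof (rule sum.mono_neutral_right)
    show "finite {l \<in> words (2 * N). body_word False l = d \<and> half_area l = half_area d + h}"
      by (rule finite_subset[of _ "words (2 * N)"]) auto
  qed (use imbalance_neq_0[of N n] in \<open>auto simp: W_def box_words_def\<close>)
  also have "\<dots> = (\<Sum>l\<in>W. real_of_int (sign_imbalance (shape_of l)))"
    by (intro sum.cong) (auto simp: W_def sign_imbalance_shape_of)
  also have "\<dots> = real_of_int (\<Sum>S\<in>shape_of ` W. sign_imbalance S)"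
    using inj_on_subset[OF inj_on_shape_of, of W N] by (simp add: W_def sum.reindex)
  also have "shape_of ` W = {S. is_shape S \<and> fb S = D \<and> card (strip S) = s \<and> hs S = h}"
    unfolding W_def n_def by (rule shape_of_image_fixed_body) (use N d n_def in simp_all)
  finally show ?thesis
    by (simp only: of_int_eq_0_iff)
qed

theorem theorem3p3:
  fixes D :: "square set" and h v s :: nat
  assumes "fourling_shape D" and "D \<noteq> {}"
  shows "(\<Sum>S | is_shape S \<and> fb S = D \<and> card (strip S) = s \<and> hs S = h \<and> vs S = v.
            sign_imbalance S) = 0"
proof (cases "h + v = s div 2")
  case True
  let ?A = "{S. is_shape S \<and> fb S = D \<and> card (strip S) = s \<and> hs S = h}"
  have "finite ?A"
    by (rule finite_subset[OF _ finite_shapes[of D s]]) auto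
  then have "(\<Sum>S | is_shape S \<and> fb S = D \<and> card (strip S) = s \<and> hs S = h \<and> vs S = v.
      sign_imbalance S) = (\<Sum>S\<in>?A. sign_imbalance S)"
    using hs_add_vs_eq_half_card_strip True by (intro sum.mono_neutral_left) force+
  also have "\<dots> = 0"
    using assms by (rule sum_sign_imbalance_fixed_hs)
  finally show ?thesis .
next
  case False
  then show ?thesis
    using hs_add_vs_eq_half_card_strip by (intro sum.neutral) auto
qed

end
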